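(* Let $K$ be a field and $X=\{x_1,\dots,x_n\}$ a finite connected poset with $n>1$. Each pure commutativity preserver $\varphi:I(X,K)\to I(X,K)$ can be uniquely represented in the form $\varphi=\tau_{\theta,\sigma,c,\kappa}$, where $\theta:\mathcal{B}\to\mathcal{B}$ is a bijection which is monotone on maximal chains in $X$; $\sigma:X^2_<\to K^*$ is $c$-compatible with $\theta$ for some $c:X^2_<\to K^*$ such that $c$ is constant on maximal chains in $X$ and the pair $(\theta,c)$ is admissible; and $\kappa=(k_1,\dots,k_n)\in K^n$ is such that $\sum_{i=1}^n k_i\in K^*$.
   Context: Basic notation. $K^*=K\setminus\{0\}$. $I(X,K)$ is the incidence algebra: functions $f:X\times X\to K$ with $f(x,y)=0$ if $x\not\le y$, with product $(fg)(x,y)=\sum_{x\le z\le y}f(x,z)g(z,y)$ and identity $\delta$. $[f,g]=fg-gf$. For $x\le y$, $e_{xy}$ is the function equal to $1$ at $(x,y)$ and $0$ elsewhere; $e_x=e_{xx}$. $X^2_<=\{(x,y)\in X^2:x<y\}$, $\mathcal{B}=\{e_{xy}:x<y\}$, and $D(X,K)$ is the span of $\{e_x:x\in X\}$ (diagonal elements). The length of a finite chain $C$ is $|C|-1$, and $l(x,y)$ is the maximal length of chains in the interval $\{z:x\le z\le y\}$. A walk in $X$ is a sequence $u_0,\dots,u_m$ in which consecutive elements $u_i,u_{i+1}$ are comparable and the interval between them has length $1$; it is closed if $u_0=u_m$. $X$ is connected if any two elements are joined by a walk. Preservers. A linear map $\varphi:I(X,K)\to I(X,K)$ is a commutativity preserver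 if $[a,b]=0$ implies $[\varphi(a),\varphi(b)]=0$; it is strong if the converse implication also holds; it preserves the diagonality if $\varphi(D(X,K))\subseteq D(X,K)$. If $\varphi$ is a bijective strong commutativity preserver that preserves the diagonality, there are a unique bijection $\theta_\varphi:\mathcal{B}\to\mathcal{B}$ and maps $\sigma_\varphi:X^2_<\to K^*$, $\nu_\varphi:\mathcal{B}\to D(X,K)$ with $\varphi(e_{xy})=\sigma_\varphi(x,y)\theta_\varphi(e_{xy})+\nu_\varphi(e_{xy})$ for all $x<y$. Such a $\varphi$ is called a pure commutativity preserver if $\nu_\varphi(e_{xy})=0$ for all $x<y$. Properties of $\theta,\sigma,c$. A bijection $\theta:\mathcal{B}\to\mathcal{B}$ is increasing (resp. decreasing) on a maximal chain $u_1<\dots<u_m$ if there is a maximal chain $v_1<\dots<v_m$ in $X$ with $\theta(e_{u_iu_j})=e_{v_iv_j}$ (resp. $\theta(e_{u_iu_j})=e_{v_{m-j+1}v_{m-i+1}}$) for all $1\le i<j\le m$; it is monotone on maximal chains in $X$ if on each maximal chain it is increasing or decreasing. Given $c:X^2_<\to K^*$, a map $\sigma:X^2_<\to K^*$ is $c$-compatible with $\theta$ if for all $x<y<z$: $\theta(e_{xz})=\theta(e_{xy})\theta(e_{yz})$ implies $c(x,z)\sigma(x,z)=\sigma(x,y)\sigma(y,z)$, and $\theta(e_{xz})=\theta(e_{yz})\theta(e_{xy})$ implies $c(x,z)\sigma(x,z)=-\sigma(x,y)\sigma(y,z)$. The map $c$ is constant on maximal chains if for every maximal chain $y_1<\dots<y_m$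 in $X$ one has $c(y_i,y_j)=c(y_1,y_m)$ for all $1\le i<j\le m$. Admissibility. For a closed walk $\Gamma:u_0,u_1,\dots,u_m=u_0$ and $z\in X$ define: $s^+_{\theta,c,\Gamma}(z)=\sum c(z,w_i)$ over those $0\le i\le m-1$ with $u_i<u_{i+1}$ for which there is $w_i>z$ with $\theta(e_{zw_i})=e_{u_iu_{i+1}}$; $s^-_{\theta,c,\Gamma}(z)=\sum c(z,w_i)$ over those $i$ with $u_i>u_{i+1}$ for which there is $w_i>z$ with $\theta(e_{zw_i})=e_{u_{i+1}u_i}$; $t^+_{\theta,c,\Gamma}(z)=\sum c(w_i,z)$ over those $i$ with $u_i<u_{i+1}$ for which there is $w_i<z$ with $\theta(e_{w_iz})=e_{u_iu_{i+1}}$; $t^-_{\theta,c,\Gamma}(z)=\sum c(w_i,z)$ over those $i$ with $u_i>u_{i+1}$ for which there is $w_i<z$ with $\theta(e_{w_iz})=e_{u_{i+1}u_i}$. The pair $(\theta,c)$ is admissible if $s^+_{\theta,c,\Gamma}(z)-s^-_{\theta,c,\Gamma}(z)=t^+_{\theta,c,\Gamma}(z)-t^-_{\theta,c,\Gamma}(z)$ for every closed walk $\Gamma$ and all $z\in X$. The map $\tau_{\theta,\sigma,c,\kappa}$. For $\theta,\sigma,c,\kappa$ with all the properties listed in the claim, $\tau=\tau_{\theta,\sigma,c,\kappa}$ is the linear map $I(X,K)\to I(X,K)$ given by $\tau(e_{xy})=\sigma(x,y)\theta(e_{xy})$ for $x<y$, $\tau(e_z)\in D(X,K)$ for all $z\in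 X$, $\tau(e_{x_i})(x_1,x_1)=k_i$ for $i=1,\dots,n$, and, for $z,v\in X$, $\tau(e_z)(v,v)=\tau(e_z)(x_1,x_1)+\sum_{i=0}^{m-1}\Delta_i(z)$, where $x_1=u_0,u_1,\dots,u_m=v$ is any walk, $v_i<w_i$ are such that $\theta(e_{v_iw_i})=e_{u_iu_{i+1}}$ if $u_i<u_{i+1}$ and $\theta(e_{v_iw_i})=e_{u_{i+1}u_i}$ if $u_i>u_{i+1}$, and $\Delta_i(z)=-c(v_i,w_i)$ if ($u_i<u_{i+1}$ and $z=v_i$) or ($u_i>u_{i+1}$ and $z=w_i$), $\Delta_i(z)=c(v_i,w_i)$ if ($u_i<u_{i+1}$ and $z=w_i$) or ($u_i>u_{i+1}$ and $z=v_i$), $\Delta_i(z)=0$ if $z\notin\{v_i,w_i\}$. (This does not depend on the choice of walks, by admissibility, and $\tau$ is a pure commutativity preserver.) *)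

theory Defs
  imports Complex_Main "HOL-Library.FuncSet"
begin

section \<open>The incidence algebra of a finite poset\<close>

typedef (overloaded) ('a, 'k) incidence =
  "{f :: 'a::order \<Rightarrow> 'a \<Rightarrow> 'k::zero. \<forall>x y. \<not> x \<le> y \<longrightarrow> f x y = 0}"
  morphisms entry Abs_incidence
  by (rule exI[of _ "\<lambda>_ _. 0"]) simp

setup_lifting type_definition_incidence

lemma incidence_eqI: "(\<And>x y. entry f x y = entry g x y) \<Longrightarrow> f = g"
  by (metis entry_inject ext)

lemma entry_eq_0: "\<not> x \<le> y \<Longrightarrow> entry f x y = 0"
  using entry[of f] by auto

instantiation incidence :: (order, ab_group_add) ab_group_add
begin
lift_definition zero_incidence :: "('a, 'b) incidence" is "\<lambda>_ _. 0" by simp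
lift_definition plus_incidence :: "('a, 'b) incidence \<Rightarrow> ('a, 'b) incidence \<Rightarrow> ('a, 'b) incidence"
  is "\<lambda>f g x y. f x y + g x y" by simp
lift_definition uminus_incidence :: "('a, 'b) incidence \<Rightarrow> ('a, 'b) incidence"
  is "\<lambda>f x y. - f x y" by simp
lift_definition minus_incidence :: "('a, 'b) incidence \<Rightarrow> ('a, 'b) incidence \<Rightarrow> ('a, 'b) incidence"
  is "\<lambda>f g x y. f x y - g x y" by simp
instance
  by standard (transfer; simp add: fun_eq_iff algebra_simps)+
end

instantiation incidence :: ("{finite, order}", ring_1) ring_1
begin
lift_definition one_incidence :: "('a, 'b) incidence" is "\<lambda>x y. if x = y then 1 else 0" by auto
lift_definition times_incidence :: "('a, 'b) incidence \<Rightarrow> ('a, 'b) incidence \<Rightarrow> ('a, 'b) incidence"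
  is "\<lambda>f g x y. \<Sum>z\<in>{x..y}. f x z * g z y" by auto

lemma entry_times: "entry (f * g) x y = (\<Sum>z\<in>UNIV. entry f x z * entry (g :: ('a, 'b) incidence) z y)"
  unfolding times_incidence.rep_eq
  by (rule sum.mono_neutral_left) (auto simp: entry_eq_0)

instance
proof
  fix f g h :: "('a, 'b) incidence"
  show "f * g * h = f * (g * h)"
  proof (rule incidence_eqI)
    fix x y
    have "entry (f * g * h) x y = (\<Sum>z\<in>UNIV. \<Sum>w\<in>UNIV. entry f x w * entry g w z * entry h z y)"
      by (simp add: entry_times sum_distrib_right)
    also have "\<dots> = (\<Sum>w\<in>UNIV. \<Sum>z\<in>UNIV. entry f x w * entry g w z * entry h z y)"
      by (rule sum.swap)
    also have "\<dots> = entry (f * (g * h)) x y"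
      by (simp add: entry_times sum_distrib_left mult.assoc)
    finally show "entry (f * g * h) x y = entry (f * (g * h)) x y" .
  qed
  show "1 * f = f"
    by (rule incidence_eqI) (simp add: entry_times one_incidence.rep_eq if_distrib if_distribR cong: if_cong)
  show "f * 1 = f"
    by (rule incidence_eqI) (simp add: entry_times one_incidence.rep_eq if_distrib if_distribR cong: if_cong)
  show "(f + g) * h = f * h + g * h"
    by (rule incidence_eqI) (simp add: entry_times plus_incidence.rep_eq algebra_simps sum.distrib)
  show "f * (g + h) = f * g + f * h"
    by (rule incidence_eqI) (simp add: entry_times plus_incidence.rep_eq algebra_simps sum.distrib)
  have "entry (0 :: ('a, 'b) incidence) x x \<noteq> entry 1 x x" for x
    by (simp add: zero_incidence.rep_eq one_incidence.rep_eq)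
  then show "(0 :: ('a, 'b) incidence) \<noteq> 1" by metis
qed
end

lift_definition iscale :: "'k::field \<Rightarrow> ('a::order, 'k) incidence \<Rightarrow> ('a, 'k) incidence"
  is "\<lambda>r f x y. r * f x y" by simp

interpretation incidence: vector_space iscale
  by standard (transfer; simp add: fun_eq_iff algebra_simps)+

interpretation incidence_pair: vector_space_pair iscale iscale ..

text \<open>The matrix unit \<open>e\<^sub>x\<^sub>y\<close>; only used for \<open>x \<le> y\<close>, with junk value \<open>0\<close> otherwise.\<close>

lift_definition munit :: "'a::order \<Rightarrow> 'a \<Rightarrow> ('a, 'k::field) incidence"
  is "\<lambda>x y u v. if x \<le> y \<and> u = x \<and> v = y then 1 else 0" by auto

definition diagonal :: "('a::order, 'k::field) incidence set" where
  "diagonal = incidence.span (range (\<lambda>x. munit x x))"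

definition strict_pairs :: "('a::order \<times> 'a) set" where
  "strict_pairs = {(x, y). x < y}"

definition strict_units :: "('a::order, 'k::field) incidence set" where
  "strict_units = {munit x y | x y. x < y}"

definition commutator :: "'r::ring \<Rightarrow> 'r \<Rightarrow> 'r" where
  "commutator f g = f * g - g * f"


section \<open>Walks and chains\<close>

definition interval_length :: "'a::{finite, order} \<Rightarrow> 'a \<Rightarrow> nat" where
  "interval_length x y =
     Max {card C - 1 | C. pred_on.chain {x..y} (<) C \<and> C \<noteq> {}}"

text \<open>A walk \<open>u\<^sub>0, \<dots>, u\<^sub>m\<close> is a function on the naturals together with \<open>m\<close>; values beyond
  \<open>m\<close> are irrelevant. Similarly, a chain \<open>u\<^sub>1 < \<dots> < u\<^sub>m\<close> is given by a function, of which
  only the values on \<open>{1..m}\<close> matter.\<close>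

definition walk :: "(nat \<Rightarrow> 'a::{finite, order}) \<Rightarrow> nat \<Rightarrow> bool" where
  "walk u m \<longleftrightarrow> (\<forall>i<m.
     (u i \<le> u (Suc i) \<and> interval_length (u i) (u (Suc i)) = 1) \<or>
     (u (Suc i) \<le> u i \<and> interval_length (u (Suc i)) (u i) = 1))"

definition closed_walk :: "(nat \<Rightarrow> 'a::{finite, order}) \<Rightarrow> nat \<Rightarrow> bool" where
  "closed_walk u m \<longleftrightarrow> walk u m \<and> u m = u 0"

definition walk_from_to :: "'a::{finite, order} \<Rightarrow> 'a \<Rightarrow> (nat \<Rightarrow> 'a) \<Rightarrow> nat \<Rightarrow> bool" where
  "walk_from_to y z u m \<longleftrightarrow> walk u m \<and> u 0 = y \<and> u m = z"

definition connected_poset :: "'a::{finite, order} itself \<Rightarrow> bool" where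
  "connected_poset _ \<longleftrightarrow> (\<forall>y z :: 'a. \<exists>u m. walk_from_to y z u m)"

definition maximal_chain :: "(nat \<Rightarrow> 'a::order) \<Rightarrow> nat \<Rightarrow> bool" where
  "maximal_chain u m \<longleftrightarrow>
     strict_mono_on {1..m} u \<and> pred_on.maxchain UNIV (<) (u ` {1..m})"


section \<open>Commutativity preservers\<close>

definition commutativity_preserver ::
    "(('a::{finite, order}, 'k::field) incidence \<Rightarrow> ('a, 'k) incidence) \<Rightarrow> bool" where
  "commutativity_preserver \<phi> \<longleftrightarrow> Vector_Spaces.linear iscale iscale \<phi> \<and>
     (\<forall>a b. commutator a b = 0 \<longrightarrow> commutator (\<phi> a) (\<phi> b) = 0)"

definition strong_commutativity_preserver ::
    "(('a::{finite, order}, 'k::field) incidence \<Rightarrow> ('a, 'k) incidence) \<Rightarrow> bool" where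
  "strong_commutativity_preserver \<phi> \<longleftrightarrow> commutativity_preserver \<phi> \<and>
     (\<forall>a b. commutator (\<phi> a) (\<phi> b) = 0 \<longrightarrow> commutator a b = 0)"

definition preserves_diagonality ::
    "(('a::{finite, order}, 'k::field) incidence \<Rightarrow> ('a, 'k) incidence) \<Rightarrow> bool" where
  "preserves_diagonality \<phi> \<longleftrightarrow> \<phi> ` diagonal \<subseteq> diagonal"

definition unit_decomposition ::
    "(('a::{finite, order}, 'k::field) incidence \<Rightarrow> ('a, 'k) incidence) \<Rightarrow>
     (('a, 'k) incidence \<Rightarrow> ('a, 'k) incidence) \<Rightarrow> ('a \<times> 'a \<Rightarrow> 'k) \<Rightarrow>
     (('a, 'k) incidence \<Rightarrow> ('a, 'k) incidence) \<Rightarrow> bool" where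
  "unit_decomposition \<phi> \<theta> \<sigma> \<nu> \<longleftrightarrow>
     bij_betw \<theta> strict_units strict_units \<and>
     \<sigma> \<in> strict_pairs \<rightarrow> - {0} \<and> \<nu> \<in> strict_units \<rightarrow> diagonal \<and>
     (\<forall>x y. x < y \<longrightarrow> \<phi> (munit x y) = iscale (\<sigma> (x, y)) (\<theta> (munit x y)) + \<nu> (munit x y))"

text \<open>The decomposition of a bijective strong commutativity preserver that preserves the
  diagonality exists and is unique (on the relevant domains), so that the existential
  quantifier below merely names it.\<close>

definition pure_commutativity_preserver ::
    "(('a::{finite, order}, 'k::field) incidence \<Rightarrow> ('a, 'k) incidence) \<Rightarrow> bool" where
  "pure_commutativity_preserver \<phi> \<longleftrightarrow>
     bij \<phi> \<and> strong_commutativity_preserver \<phi> \<and> preserves_diagonality \<phi> \<and>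
     (\<exists>\<theta> \<sigma> \<nu>. unit_decomposition \<phi> \<theta> \<sigma> \<nu> \<and> (\<forall>x y. x < y \<longrightarrow> \<nu> (munit x y) = 0))"


section \<open>Properties of \<open>\<theta>\<close>, \<open>\<sigma>\<close> and \<open>c\<close>\<close>

definition increasing_on_chain ::
    "(('a::order, 'k::field) incidence \<Rightarrow> ('a, 'k) incidence) \<Rightarrow> (nat \<Rightarrow> 'a) \<Rightarrow> nat \<Rightarrow> bool" where
  "increasing_on_chain \<theta> u m \<longleftrightarrow> (\<exists>v. maximal_chain v m \<and>
     (\<forall>i j. 1 \<le> i \<and> i < j \<and> j \<le> m \<longrightarrow> \<theta> (munit (u i) (u j)) = munit (v i) (v j)))"

definition decreasing_on_chain ::
    "(('a::order, 'k::field) incidence \<Rightarrow> ('a, 'k) incidence) \<Rightarrow> (nat \<Rightarrow> 'a) \<Rightarrow> nat \<Rightarrow> bool" where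
  "decreasing_on_chain \<theta> u m \<longleftrightarrow> (\<exists>v. maximal_chain v m \<and>
     (\<forall>i j. 1 \<le> i \<and> i < j \<and> j \<le> m \<longrightarrow>
        \<theta> (munit (u i) (u j)) = munit (v (m - j + 1)) (v (m - i + 1))))"

definition monotone_on_maximal_chains ::
    "(('a::order, 'k::field) incidence \<Rightarrow> ('a, 'k) incidence) \<Rightarrow> bool" where
  "monotone_on_maximal_chains \<theta> \<longleftrightarrow> (\<forall>u m. maximal_chain u m \<longrightarrow>
     increasing_on_chain \<theta> u m \<or> decreasing_on_chain \<theta> u m)"

definition compatible ::
    "(('a::{finite, order}, 'k::field) incidence \<Rightarrow> ('a, 'k) incidence) \<Rightarrow>
     ('a \<times> 'a \<Rightarrow> 'k) \<Rightarrow> ('a \<times> 'a \<Rightarrow> 'k) \<Rightarrow> bool" where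
  "compatible \<theta> c \<sigma> \<longleftrightarrow> (\<forall>x y z. x < y \<and> y < z \<longrightarrow>
     (\<theta> (munit x z) = \<theta> (munit x y) * \<theta> (munit y z) \<longrightarrow>
        c (x, z) * \<sigma> (x, z) = \<sigma> (x, y) * \<sigma> (y, z)) \<and>
     (\<theta> (munit x z) = \<theta> (munit y z) * \<theta> (munit x y) \<longrightarrow>
        c (x, z) * \<sigma> (x, z) = - (\<sigma> (x, y) * \<sigma> (y, z))))"

definition constant_on_maximal_chains :: "('a::order \<times> 'a \<Rightarrow> 'k) \<Rightarrow> bool" where
  "constant_on_maximal_chains c \<longleftrightarrow> (\<forall>y m. maximal_chain y m \<longrightarrow>
     (\<forall>i j. 1 \<le> i \<and> i < j \<and> j \<le> m \<longrightarrow> c (y i, y j) = c (y 1, y m)))"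

text \<open>The sums below range over pairs \<open>(i, w)\<close> consisting of an index and an associated
  element \<open>w = w\<^sub>i\<close>. For \<open>\<theta>\<close> injective on \<^const>\<open>strict_units\<close> there is at most one such \<open>w\<close>
  for each \<open>i\<close>, so these are sums over the indices \<open>i\<close> for which \<open>w\<^sub>i\<close> exists.\<close>

definition s_plus ::
    "(('a::{finite, order}, 'k::field) incidence \<Rightarrow> ('a, 'k) incidence) \<Rightarrow> ('a \<times> 'a \<Rightarrow> 'k) \<Rightarrow>
     (nat \<Rightarrow> 'a) \<Rightarrow> nat \<Rightarrow> 'a \<Rightarrow> 'k" where
  "s_plus \<theta> c u m z = (\<Sum>(i, w) \<in> {(i, w). i < m \<and> u i < u (Suc i) \<and> z < w \<and>
     \<theta> (munit z w) = munit (u i) (u (Suc i))}. c (z, w))"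

definition s_minus ::
    "(('a::{finite, order}, 'k::field) incidence \<Rightarrow> ('a, 'k) incidence) \<Rightarrow> ('a \<times> 'a \<Rightarrow> 'k) \<Rightarrow>
     (nat \<Rightarrow> 'a) \<Rightarrow> nat \<Rightarrow> 'a \<Rightarrow> 'k" where
  "s_minus \<theta> c u m z = (\<Sum>(i, w) \<in> {(i, w). i < m \<and> u (Suc i) < u i \<and> z < w \<and>
     \<theta> (munit z w) = munit (u (Suc i)) (u i)}. c (z, w))"

definition t_plus ::
    "(('a::{finite, order}, 'k::field) incidence \<Rightarrow> ('a, 'k) incidence) \<Rightarrow> ('a \<times> 'a \<Rightarrow> 'k) \<Rightarrow>
     (nat \<Rightarrow> 'a) \<Rightarrow> nat \<Rightarrow> 'a \<Rightarrow> 'k" where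
  "t_plus \<theta> c u m z = (\<Sum>(i, w) \<in> {(i, w). i < m \<and> u i < u (Suc i) \<and> w < z \<and>
     \<theta> (munit w z) = munit (u i) (u (Suc i))}. c (w, z))"

definition t_minus ::
    "(('a::{finite, order}, 'k::field) incidence \<Rightarrow> ('a, 'k) incidence) \<Rightarrow> ('a \<times> 'a \<Rightarrow> 'k) \<Rightarrow>
     (nat \<Rightarrow> 'a) \<Rightarrow> nat \<Rightarrow> 'a \<Rightarrow> 'k" where
  "t_minus \<theta> c u m z = (\<Sum>(i, w) \<in> {(i, w). i < m \<and> u (Suc i) < u i \<and> w < z \<and>
     \<theta> (munit w z) = munit (u (Suc i)) (u i)}. c (w, z))"

definition admissible ::
    "(('a::{finite, order}, 'k::field) incidence \<Rightarrow> ('a, 'k) incidence) \<Rightarrow> ('a \<times> 'a \<Rightarrow> 'k) \<Rightarrow>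
     bool" where
  "admissible \<theta> c \<longleftrightarrow> (\<forall>u m z. closed_walk u m \<longrightarrow>
     s_plus \<theta> c u m z - s_minus \<theta> c u m z = t_plus \<theta> c u m z - t_minus \<theta> c u m z)"


section \<open>The map \<open>\<tau>\<close>\<close>

definition preimage_pair ::
    "(('a::order, 'k::field) incidence \<Rightarrow> ('a, 'k) incidence) \<Rightarrow> 'a \<Rightarrow> 'a \<Rightarrow> 'a \<times> 'a" where
  "preimage_pair \<theta> p q = (THE (v, w). v < w \<and> \<theta> (munit v w) = munit p q)"

text \<open>The contribution \<open>\<Delta>\<^sub>i(z)\<close> of a step from \<open>p = u\<^sub>i\<close> to \<open>q = u\<^sub>i\<^sub>+\<^sub>1\<close>.\<close>

definition step_contribution ::
    "(('a::order, 'k::field) incidence \<Rightarrow> ('a, 'k) incidence) \<Rightarrow> ('a \<times> 'a \<Rightarrow> 'k) \<Rightarrow>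
     'a \<Rightarrow> 'a \<Rightarrow> 'a \<Rightarrow> 'k" where
  "step_contribution \<theta> c p q z =
     (let (v, w) = (if p < q then preimage_pair \<theta> p q else preimage_pair \<theta> q p) in
      if p < q \<and> z = v \<or> q < p \<and> z = w then - c (v, w)
      else if p < q \<and> z = w \<or> q < p \<and> z = v then c (v, w)
      else 0)"

text \<open>The entry \<open>\<tau>(e\<^sub>z)(v, v)\<close> for \<open>z = x\<^sub>i\<close>. The walk from \<open>x\<^sub>1\<close> to \<open>v\<close> is arbitrary; see
  \<open>tau_entry_walk\<close> below for the independence of its choice.\<close>

definition tau_entry ::
    "(nat \<Rightarrow> 'a::{finite, order}) \<Rightarrow> (('a, 'k::field) incidence \<Rightarrow> ('a, 'k) incidence) \<Rightarrow>
     ('a \<times> 'a \<Rightarrow> 'k) \<Rightarrow> (nat \<Rightarrow> 'k) \<Rightarrow> nat \<Rightarrow> 'a \<Rightarrow> 'k" where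
  "tau_entry x \<theta> c \<kappa> i v =
     (let (u, m) = (SOME (u, m). walk_from_to (x 1) v u m) in
      \<kappa> i + (\<Sum>j<m. step_contribution \<theta> c (u j) (u (Suc j)) (x i)))"

definition tau ::
    "(nat \<Rightarrow> 'a::{finite, order}) \<Rightarrow> nat \<Rightarrow> (('a, 'k::field) incidence \<Rightarrow> ('a, 'k) incidence) \<Rightarrow>
     ('a \<times> 'a \<Rightarrow> 'k) \<Rightarrow> ('a \<times> 'a \<Rightarrow> 'k) \<Rightarrow> (nat \<Rightarrow> 'k) \<Rightarrow>
     ('a, 'k) incidence \<Rightarrow> ('a, 'k) incidence" where
  "tau x n \<theta> \<sigma> c \<kappa> f =
     (\<Sum>(y, z)\<in>strict_pairs. iscale (entry f y z) (iscale (\<sigma> (y, z)) (\<theta> (munit y z)))) +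
     (\<Sum>i=1..n. iscale (entry f (x i) (x i)) (\<Sum>v\<in>UNIV. iscale (tau_entry x \<theta> c \<kappa> i v) (munit v v)))"


lemma linear_sum_iscale_entry:
  "Vector_Spaces.linear iscale iscale (\<lambda>f. \<Sum>i\<in>I. iscale (entry f (a i) (b i)) (F i))"
  by unfold_locales
    (simp_all add: plus_incidence.rep_eq iscale.rep_eq incidence.scale_left_distrib
      sum.distrib incidence.scale_sum_right)

lemma linear_tau: "Vector_Spaces.linear iscale iscale (tau x n \<theta> \<sigma> c \<kappa>)"
  unfolding tau_def case_prod_unfold
  by (intro incidence_pair.linear_compose_add linear_sum_iscale_entry)

lemma tau_munit:
  assumes "y < z"
  shows "tau x n \<theta> \<sigma> c \<kappa> (munit y z) = iscale (\<sigma> (y, z)) (\<theta> (munit y z))"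
proof -
  have "(\<Sum>(a, b)\<in>strict_pairs. iscale (entry (munit y z) a b) (iscale (\<sigma> (a, b)) (\<theta> (munit a b))))
      = (\<Sum>p\<in>strict_pairs. if p = (y, z) then iscale (\<sigma> (y, z)) (\<theta> (munit y z)) else 0)"
    using assms by (intro sum.cong) (auto simp: munit.rep_eq split: if_splits)
  also have "\<dots> = iscale (\<sigma> (y, z)) (\<theta> (munit y z))"
    using assms by (subst sum.delta) (auto simp: strict_pairs_def)
  finally show ?thesis
    using assms by (auto simp: tau_def munit.rep_eq intro!: sum.neutral)
qed

lemma tau_munit_diagonal:
  assumes "bij_betw x {1..n} UNIV" "i \<in> {1..n}"
  shows "tau x n \<theta> \<sigma> c \<kappa> (munit (x i) (x i)) =
    (\<Sum>v\<in>UNIV. iscale (tau_entry x \<theta> c \<kappa> i v) (munit v v))"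
proof -
  have diag: "entry (munit (x i) (x i) :: ('a, 'b) incidence) (x j) (x j) = (if j = i then 1 else 0)"
    if "j \<in> {1..n}" for j
  proof -
    have "x j = x i \<longleftrightarrow> j = i"
      by (rule inj_on_eq_iff[OF bij_betw_imp_inj_on[OF assms(1)] that assms(2)])
    then show ?thesis by (simp add: munit.rep_eq)
  qed
  have off_diag: "entry (munit (x i) (x i) :: ('a, 'b) incidence) a b = 0" if "a < b" for a b
    using that by (auto simp: munit.rep_eq)
  have "(\<Sum>j=1..n. iscale (entry (munit (x i) (x i)) (x j) (x j))
          (\<Sum>v\<in>UNIV. iscale (tau_entry x \<theta> c \<kappa> j v) (munit v v)))
      = (\<Sum>j=1..n. if j = i then \<Sum>v\<in>UNIV. iscale (tau_entry x \<theta> c \<kappa> i v) (munit v v) else 0)"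
  proof (rule sum.cong[OF refl])
    fix j assume "j \<in> {1..n}"
    then show "iscale (entry (munit (x i) (x i)) (x j) (x j))
          (\<Sum>v\<in>UNIV. iscale (tau_entry x \<theta> c \<kappa> j v) (munit v v)) =
        (if j = i then \<Sum>v\<in>UNIV. iscale (tau_entry x \<theta> c \<kappa> i v) (munit v v) else 0)"
      using diag[of j] by (cases "j = i") simp_all
  qed
  also have "\<dots> = (\<Sum>v\<in>UNIV. iscale (tau_entry x \<theta> c \<kappa> i v) (munit v v))"
    using assms(2) by (subst sum.delta) auto
  finally have "(\<Sum>j=1..n. iscale (entry (munit (x i) (x i)) (x j) (x j))
          (\<Sum>v\<in>UNIV. iscale (tau_entry x \<theta> c \<kappa> j v) (munit v v))) =
        (\<Sum>v\<in>UNIV. iscale (tau_entry x \<theta> c \<kappa> i v) (munit v v))" .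
  moreover have "(\<Sum>(a, b)\<in>strict_pairs.
      iscale (entry (munit (x i) (x i)) a b) (iscale (\<sigma> (a, b)) (\<theta> (munit a b)))) = 0"
    by (rule sum.neutral) (clarsimp simp: strict_pairs_def off_diag)
  ultimately show ?thesis by (simp only: tau_def add_0_left)
qed

lemma entry_tau_munit_diagonal:
  assumes "bij_betw x {1..n} UNIV" "i \<in> {1..n}"
  shows "entry (tau x n \<theta> \<sigma> c \<kappa> (munit (x i) (x i))) v v = tau_entry x \<theta> c \<kappa> i v"
proof -
  have *: "entry (\<Sum>w\<in>A. F w) v v = (\<Sum>w\<in>A. entry (F w) v v)"
    if "finite A" for A and F :: "'a \<Rightarrow> ('a, 'b) incidence" and v :: 'a
    using that by induction (simp_all add: zero_incidence.rep_eq plus_incidence.rep_eq)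
  show ?thesis
    by (simp add: tau_munit_diagonal[OF assms] * iscale.rep_eq munit.rep_eq if_distrib cong: if_cong)
qed

lemma preimage_pair:
  assumes "bij_betw \<theta> strict_units strict_units" "p < q"
  obtains v w where "preimage_pair \<theta> p q = (v, w)" "v < w" "\<theta> (munit v w) = munit p q"
    "\<forall>a b. a < b \<longrightarrow> (\<theta> (munit a b) = munit p q \<longleftrightarrow> a = v \<and> b = w)"
proof -
  have munit_eq: "a = b \<and> a' = b'"
    if "munit a a' = (munit b b' :: ('a, 'b) incidence)" "a < a'" for a a' b b' :: 'a
  proof -
    have "entry (munit a a' :: ('a, 'b) incidence) a a' = entry (munit b b') a a'"
      using that by simp
    then show ?thesis using that(2) by (auto simp: munit.rep_eq split: if_splits)
  qed
  have "munit p q \<in> \<theta> ` strict_units"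
    using assms by (auto simp: bij_betw_def strict_units_def)
  then obtain v w where vw: "v < w" "\<theta> (munit v w) = munit p q"
    by (auto simp: strict_units_def)
  have uniq: "\<theta> (munit a b) = munit p q \<longleftrightarrow> a = v \<and> b = w" if "a < b" for a b
  proof
    assume "\<theta> (munit a b) = munit p q"
    then have "\<theta> (munit a b) = \<theta> (munit v w)" using vw by simp
    moreover have "munit a b \<in> strict_units" "munit v w \<in> strict_units"
      using vw that by (auto simp: strict_units_def)
    ultimately have "munit a b = (munit v w :: ('a, 'b) incidence)"
      by (rule inj_onD[OF bij_betw_imp_inj_on[OF assms(1)]])
    then show "a = v \<and> b = w" using munit_eq that by blast
  qed (use vw in auto)
  have "preimage_pair \<theta> p q = (v, w)"
    unfolding preimage_pair_def by (rule the_equality) (use vw uniq in auto)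
  then show ?thesis using vw uniq that by blast
qed

lemma step_contribution_swap:
  assumes bij: "bij_betw \<theta> strict_units strict_units"
  shows "step_contribution \<theta> c q p z = - step_contribution \<theta> c p q z"
proof -
  consider "p < q" | "q < p" | "\<not> p < q" "\<not> q < p" by blast
  then show ?thesis
  proof cases
    case 1
    obtain v w where "preimage_pair \<theta> p q = (v, w)" "v < w"
      using bij 1 by (elim preimage_pair)
    with 1 show ?thesis by (auto simp: step_contribution_def)
  next
    case 2
    obtain v w where "preimage_pair \<theta> q p = (v, w)" "v < w"
      using bij 2 by (elim preimage_pair)
    with 2 show ?thesis by (auto simp: step_contribution_def)
  qed (auto simp: step_contribution_def split: prod.splits)
qed

lemma sum_step_contribution:
  assumes "bij_betw \<theta> strict_units strict_units"
  shows "(\<Sum>j<m. step_contribution \<theta> c (u j) (u (Suc j)) z) =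
    (t_plus \<theta> c u m z - t_minus \<theta> c u m z) - (s_plus \<theta> c u m z - s_minus \<theta> c u m z)"
proof -
  have split: "(\<Sum>(i, w) \<in> {(i, w). i < m \<and> P i w}. f w) = (\<Sum>i<m. \<Sum>w\<in>{w. P i w}. f w)"
    for P and f :: "'a \<Rightarrow> 'b"
    by (subst sum.Sigma) (auto intro!: sum.cong)
  have one: "(\<Sum>w\<in>{w. w = a \<and> Q}. f w) = (if Q then f a else 0)" for a Q and f :: "'a \<Rightarrow> 'b"
    by auto
  have "step_contribution \<theta> c p q z =
      ((\<Sum>w\<in>{w. p < q \<and> w < z \<and> \<theta> (munit w z) = munit p q}. c (w, z)) -
       (\<Sum>w\<in>{w. q < p \<and> w < z \<and> \<theta> (munit w z) = munit q p}. c (w, z))) -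
      ((\<Sum>w\<in>{w. p < q \<and> z < w \<and> \<theta> (munit z w) = munit p q}. c (z, w)) -
       (\<Sum>w\<in>{w. q < p \<and> z < w \<and> \<theta> (munit z w) = munit q p}. c (z, w)))" (is "_ = ?rhs p q") for p q
  proof -
    consider "p < q" | "q < p" | "\<not> p < q" "\<not> q < p" by blast
    then show ?thesis
    proof cases
      case 1
      obtain v w where vw: "preimage_pair \<theta> p q = (v, w)" "v < w"
        "\<theta> (munit v w) = munit p q"
        "\<forall>a b. a < b \<longrightarrow> (\<theta> (munit a b) = munit p q \<longleftrightarrow> a = v \<and> b = w)"
        by (rule preimage_pair[OF assms 1])
      have *: "{a. a < z \<and> \<theta> (munit a z) = munit p q} = {a. a = v \<and> z = w}"
        "{b. z < b \<and> \<theta> (munit z b) = munit p q} = {b. b = w \<and> z = v}"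
        using vw by auto
      have "\<not> q < p" using 1 by auto
      with 1 have "?rhs p q = (if z = w then c (v, z) else 0) - (if z = v then c (z, w) else 0)"
        by (simp add: * one)
      with 1 vw(1,2) \<open>\<not> q < p\<close> show ?thesis by (auto simp: step_contribution_def)
    next
      case 2
      obtain v w where vw: "preimage_pair \<theta> q p = (v, w)" "v < w"
        "\<theta> (munit v w) = munit q p"
        "\<forall>a b. a < b \<longrightarrow> (\<theta> (munit a b) = munit q p \<longleftrightarrow> a = v \<and> b = w)"
        by (rule preimage_pair[OF assms 2])
      have *: "{a. a < z \<and> \<theta> (munit a z) = munit q p} = {a. a = v \<and> z = w}"
        "{b. z < b \<and> \<theta> (munit z b) = munit q p} = {b. b = w \<and> z = v}"
        using vw by auto
      have "\<not> p < q" using 2 by auto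
      with 2 have "?rhs p q = (if z = v then c (z, w) else 0) - (if z = w then c (v, z) else 0)"
        by (simp add: * one)
      with 2 vw(1,2) \<open>\<not> p < q\<close> show ?thesis by (auto simp: step_contribution_def)
    qed (auto simp: step_contribution_def split: prod.splits)
  qed
  then show ?thesis
    by (simp add: s_plus_def s_minus_def t_plus_def t_minus_def split sum_subtractf)
qed

lemma tau_entry_walk:
  assumes \<theta>: "bij_betw \<theta> strict_units strict_units" and adm: "admissible \<theta> c"
    and w: "walk_from_to (x 1) v u m"
  shows "tau_entry x \<theta> c \<kappa> i v = \<kappa> i + (\<Sum>j<m. step_contribution \<theta> c (u j) (u (Suc j)) (x i))"
proof -
  let ?S = "\<lambda>p q. step_contribution \<theta> c p q (x i)"
  obtain u' m' where um': "(SOME (u, m). walk_from_to (x 1) v u m) = (u', m')" by fastforce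
  have w': "walk_from_to (x 1) v u' m'"
    using someI[of "\<lambda>(u, m). walk_from_to (x 1) v u m" "(u, m)"] w um' by auto
  define g where "g = (\<lambda>j. if j \<le> m then u j else u' (m + m' - j))"
  have g1: "g j = u j" if "j \<le> m" for j using that by (simp add: g_def)
  have g2: "g (m + j) = u' (m' - j)" for j
    using w w' by (auto simp: g_def walk_from_to_def)
  have "walk g (m + m')"
    unfolding walk_def
  proof (intro allI impI)
    fix j assume j: "j < m + m'"
    show "g j \<le> g (Suc j) \<and> interval_length (g j) (g (Suc j)) = 1 \<or>
      g (Suc j) \<le> g j \<and> interval_length (g (Suc j)) (g j) = 1"
    proof (cases "j < m")
      case True
      then show ?thesis using w by (simp add: g1 walk_from_to_def walk_def)
    next
      case False
      then obtain k where k: "j = m + k" by (metis le_Suc_ex not_less)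
      have "Suc (m' - Suc k) = m' - k" "m' - Suc k < m'" using j k by auto
      then show ?thesis
        using w' g2[of k] g2[of "Suc k"] k unfolding walk_from_to_def walk_def
        by (metis add_Suc_right)
    qed
  qed
  moreover have "g (m + m') = g 0"
    using w w' g2[of m'] by (simp add: g1 walk_from_to_def)
  ultimately have "(\<Sum>j<m + m'. ?S (g j) (g (Suc j))) = 0"
    using adm by (simp add: sum_step_contribution[OF \<theta>] admissible_def closed_walk_def)
  also have "(\<Sum>j<m + m'. ?S (g j) (g (Suc j))) =
      (\<Sum>j<m. ?S (g j) (g (Suc j))) + (\<Sum>j<m'. ?S (g (m + j)) (g (m + Suc j)))"
    by (induction m') (simp_all add: add.assoc)
  also have "(\<Sum>j<m. ?S (g j) (g (Suc j))) = (\<Sum>j<m. ?S (u j) (u (Suc j)))"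
    by (intro sum.cong) (auto simp: g1)
  also have "(\<Sum>j<m'. ?S (g (m + j)) (g (m + Suc j))) =
      (\<Sum>j<m'. - ?S (u' (m' - Suc j)) (u' (Suc (m' - Suc j))))"
    unfolding g2 using Suc_diff_Suc by (intro sum.cong refl) (metis lessThan_iff step_contribution_swap[OF \<theta>])
  also have "\<dots> = (\<Sum>j<m'. - ?S (u' j) (u' (Suc j)))"
    by (rule sum.nat_diff_reindex)
  finally have "(\<Sum>j<m. ?S (u j) (u (Suc j))) = (\<Sum>j<m'. ?S (u' j) (u' (Suc j)))"
    by (simp add: sum_negf)
  then show ?thesis unfolding tau_entry_def um' by simp
qed

end

(* For a pure commutativity preserver phi let T be the bijection of strict pairs with
   theta(e_xy) = e_T(x,y). If T(v,w) = (p,q), then phi(e_z) commutes with e_pq exactly when z is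
   neither v nor w, so the diagonal entries of phi(e_z) at p and q differ only for z = v and z = w.
   Since phi(1) is central, these two differences are opposite, and c(v,w) is their common value up
   to sign; summing along walks gives the formula for tau and admissibility. For x < y < z the pairs
   T(x,y) and T(y,z) share an endpoint, because e_xy and e_yz do not commute; comparing diagonal
   differences across the composite pair shows that its preimage is (x,z) and that c agrees on the
   three pairs. Hence T is monotone on chains and c is constant on maximal chains.

   Conversely, the steps of a walk are covers, so tau determines c at the pairs that theta maps to
   covers; every maximal chain contains such a pair, and c is constant on maximal chains. *)

theory Submission
  imports Defs
begin

section \<open>Matrix units\<close>

lemmas entry_simps = zero_incidence.rep_eq plus_incidence.rep_eq minus_incidence.rep_eq
  uminus_incidence.rep_eq iscale.rep_eq munit.rep_eq

lemma entry_sum: "entry (\<Sum>i\<in>I. F i) u v = (\<Sum>i\<in>I. entry (F i) u v)"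
  by (induction I rule: infinite_finite_induct) (simp_all add: entry_simps)

lemma munit_inject:
  assumes "x < y"
  shows "munit x y = (munit u v :: ('a::order, 'k::field) incidence) \<longleftrightarrow> x = u \<and> y = v"
proof
  assume "munit x y = (munit u v :: ('a, 'k) incidence)"
  then have "entry (munit x y :: ('a, 'k) incidence) x y = entry (munit u v) x y"
    by simp
  then show "x = u \<and> y = v"
    using assms by (auto simp: munit.rep_eq split: if_splits)
qed simp

lemma munit_neq_0: "x \<le> y \<Longrightarrow> munit x y \<noteq> (0 :: ('a::order, 'k::field) incidence)"
  by (metis munit.rep_eq zero_incidence.rep_eq zero_neq_one)

lemma iscale_munit_inject:
  assumes "x < y" "r \<noteq> 0" "s \<noteq> 0" "iscale r (munit x y) = iscale s (munit u v)"
  shows "x = u \<and> y = v \<and> r = s"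
proof -
  have "entry (iscale r (munit x y)) x y = entry (iscale s (munit u v)) x y"
    using assms(4) by simp
  then show ?thesis
    using assms(1-3) by (auto simp: entry_simps split: if_splits)
qed

lemma munit_times_munit:
  assumes "a \<le> b" "c \<le> d"
  shows "munit a b * munit c d =
    (if b = c then munit a d else (0 :: ('a::{finite, order}, 'k::field) incidence))"
proof (rule incidence_eqI)
  fix u v
  have "entry (munit a b * munit c d :: ('a, 'k) incidence) u v =
      (\<Sum>z\<in>UNIV. if z = b then if u = a \<and> b = c \<and> v = d then 1 else 0 else 0)"
    using assms unfolding entry_times munit.rep_eq by (intro sum.cong) auto
  also have "\<dots> = entry (if b = c then munit a d else (0 :: ('a, 'k) incidence)) u v"
    using assms by (auto simp: entry_simps)
  finally show "entry (munit a b * munit c d) u v =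
      entry (if b = c then munit a d else (0 :: ('a, 'k) incidence)) u v" .
qed

lemma iscale_times_left: "iscale r f * g = iscale r (f * g)"
  for f g :: "('a::{finite, order}, 'k::field) incidence"
  by (rule incidence_eqI) (simp add: entry_times entry_simps sum_distrib_left mult.assoc)

lemma iscale_times_right: "f * iscale r g = iscale r (f * g)"
  for f g :: "('a::{finite, order}, 'k::field) incidence"
  by (rule incidence_eqI) (simp add: entry_times entry_simps sum_distrib_left mult.left_commute)

lemma commutator_iscale_iscale:
  "commutator (iscale r f) (iscale s g) = iscale (r * s) (commutator f g)"
  for f g :: "('a::{finite, order}, 'k::field) incidence"
  by (simp add: commutator_def iscale_times_left iscale_times_right
      incidence.scale_right_diff_distrib mult.commute)

text \<open>At most one of the two products survives, since both surviving would force
  \<open>x < y = u < v = x\<close>. So nothing can cancel, and the bracket vanishes only if both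
  products do.\<close>

lemma commutator_munit_munit_eq_0_iff:
  assumes "x < y" "u < v"
  shows "commutator (munit x y) (munit u v :: ('a::{finite, order}, 'k::field) incidence) = 0
    \<longleftrightarrow> y \<noteq> u \<and> v \<noteq> x"
proof -
  have "munit x v \<noteq> (0 :: ('a, 'k) incidence)" if "y = u"
    using assms that by (intro munit_neq_0) auto
  moreover have "munit u y \<noteq> (0 :: ('a, 'k) incidence)" if "v = x"
    using assms that by (intro munit_neq_0) auto
  moreover have "\<not> (y = u \<and> v = x)"
    using assms by auto
  ultimately show ?thesis
    using assms by (auto simp: commutator_def munit_times_munit)
qed

section \<open>Diagonal elements and their brackets with matrix units\<close>

lemma munit_diagonal: "munit z z \<in> diagonal"
  by (auto simp: diagonal_def intro: incidence.span_base)

lemma entry_diagonal: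
  assumes "d \<in> diagonal" "x \<noteq> y"
  shows "entry d x y = 0"
  using assms(1) unfolding diagonal_def
  by (induction rule: incidence.span_induct_alt)
    (use assms(2) in \<open>auto simp: entry_simps split: if_splits\<close>)

text \<open>Matrix units are eigenvectors of the bracket with a diagonal element. The eigenvalue is
  how commutation relations turn into information about diagonal entries.\<close>

lemma commutator_diagonal_munit:
  fixes d :: "('a::{finite, order}, 'k::field) incidence"
  assumes "d \<in> diagonal" "p \<le> q"
  shows "commutator d (munit p q) = iscale (entry d p p - entry d q q) (munit p q)"
proof (rule incidence_eqI)
  fix u v
  have "entry (d * munit p q) u v = (\<Sum>z\<in>UNIV. if z = p then if v = q then entry d u p else 0 else 0)"
    using assms(2) unfolding entry_times munit.rep_eq by (intro sum.cong) auto
  moreover have "entry (munit p q * d) u v = (\<Sum>z\<in>UNIV. if z = q then if u = p then entry d q v else 0 else 0)"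
    using assms(2) unfolding entry_times munit.rep_eq by (intro sum.cong) auto
  ultimately show "entry (commutator d (munit p q)) u v =
      entry (iscale (entry d p p - entry d q q) (munit p q)) u v"
    using assms by (auto simp: commutator_def entry_simps entry_diagonal)
qed

lemma commutator_diagonal_munit_eq_0_iff:
  assumes "d \<in> diagonal" "p \<le> q"
  shows "commutator d (munit p q) = 0 \<longleftrightarrow> entry d p p = entry d q q"
  by (simp add: commutator_diagonal_munit[OF assms] munit_neq_0[OF assms(2)])

lemma span_munit:
  "incidence.span {munit x y | x y. x \<le> y} = (UNIV :: ('a::{finite, order}, 'k::field) incidence set)"
proof (intro equalityI subsetI UNIV_I)
  fix f :: "('a, 'k) incidence"
  have "f = (\<Sum>x\<in>UNIV. \<Sum>y\<in>UNIV. iscale (entry f x y) (munit x y))"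
  proof (rule incidence_eqI)
    fix u v
    have "(\<Sum>x\<in>UNIV. \<Sum>y\<in>UNIV. entry (iscale (entry f x y) (munit x y)) u v) =
        (\<Sum>x\<in>UNIV. if x = u then \<Sum>y\<in>UNIV. if y = v then entry f u v else 0 else 0)"
    proof (intro sum.cong refl)
      fix x
      have "(\<Sum>y\<in>UNIV. entry (iscale (entry f x y) (munit x y)) u v) =
          (\<Sum>y\<in>UNIV. if y = v then if x = u then entry f u v else 0 else 0)"
        by (intro sum.cong refl) (auto simp: entry_simps entry_eq_0)
      then show "(\<Sum>y\<in>UNIV. entry (iscale (entry f x y) (munit x y)) u v) =
          (if x = u then \<Sum>y\<in>UNIV. if y = v then entry f u v else 0 else 0)"
        by simp
    qed
    then show "entry f u v = entry (\<Sum>x\<in>UNIV. \<Sum>y\<in>UNIV. iscale (entry f x y) (munit x y)) u v"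
      by (simp add: entry_sum)
  qed
  moreover have "iscale (entry f x y) (munit x y) \<in> incidence.span {munit x y | x y. x \<le> y}" for x y
  proof (cases "x \<le> y")
    case True
    then show ?thesis
      by (intro incidence.span_scale incidence.span_base) auto
  qed (simp add: entry_eq_0 incidence.span_zero)
  ultimately show "f \<in> incidence.span {munit x y | x y. x \<le> y}"
    by (metis (no_types, lifting) incidence.span_sum)
qed

lemma one_incidence_eq_sum: "1 = (\<Sum>z\<in>UNIV. munit z z :: ('a::{finite, order}, 'k::field) incidence)"
proof (rule incidence_eqI)
  fix u v :: 'a
  have "(\<Sum>z\<in>UNIV. entry (munit z z :: ('a, 'k) incidence) u v) =
      (\<Sum>z\<in>UNIV. if z = u then if u = v then 1 else 0 else 0)"
    by (intro sum.cong) (auto simp: munit.rep_eq)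
  then show "entry (1 :: ('a, 'k) incidence) u v = entry (\<Sum>z\<in>UNIV. munit z z) u v"
    by (simp add: entry_sum one_incidence.rep_eq)
qed


section \<open>Chains\<close>

text \<open>An element comparable with every member could otherwise be added to the chain,
  contradicting maximality.\<close>

lemma maximal_chain_insert:
  assumes "maximal_chain u m" and "\<And>k. k \<in> {1..m} \<Longrightarrow> r < u k \<or> r = u k \<or> u k < r"
  shows "r \<in> u ` {1..m}"
proof (rule ccontr)
  assume r: "r \<notin> u ` {1..m}"
  have max: "pred_on.maxchain UNIV (<) (u ` {1..m})"
    using assms(1) by (simp add: maximal_chain_def)
  then have "pred_on.chain UNIV (<) (u ` {1..m})"
    by (rule pred_on.maxchain_imp_chain)
  then have "pred_on.chain UNIV (<) (insert r (u ` {1..m}))"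
    using assms(2) unfolding pred_on.chain_def by (simp add: image_iff) (metis atLeastAtMost_iff)
  then show False
    using r max unfolding pred_on.maxchain_def by blast
qed

text \<open>An element strictly between two neighbours is comparable with the whole chain, so
  maximality puts it into the chain, where no index is left for it.\<close>

lemma maximal_chain_covering:
  fixes u :: "nat \<Rightarrow> 'a::order"
  assumes "maximal_chain u m" "1 \<le> i" "Suc i \<le> m"
  shows "u i < u (Suc i)" "\<not> (u i < r \<and> r < u (Suc i))"
proof -
  have mono: "strict_mono_on {1..m} u"
    using assms(1) by (simp add: maximal_chain_def)
  show "u i < u (Suc i)"
    using strict_mono_onD[OF mono] assms by simp
  show "\<not> (u i < r \<and> r < u (Suc i))"
  proof
    assume r: "u i < r \<and> r < u (Suc i)"
    have less: "u j < u k" if "1 \<le> j" "j < k" "k \<le> m" for j k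
      using strict_mono_onD[OF mono] that by simp
    have "u k < r \<or> r < u k" if "k \<in> {1..m}" for k
    proof (cases "k \<le> i")
      case True
      then have "u k \<le> u i" using less[of k i] that assms by (cases "k = i") auto
      then show ?thesis using r by auto
    next
      case False
      then have "u (Suc i) \<le> u k" using less[of "Suc i" k] that assms by (cases "k = Suc i") auto
      then show ?thesis using r by auto
    qed
    then obtain k where k: "k \<in> {1..m}" "r = u k"
      using maximal_chain_insert[OF assms(1), of r] by blast
    then consider "k = i" | "k < i" | "k = Suc i" | "Suc i < k" by linarith
    then show False
    proof cases
      case 2
      then have "u k < u i" using less k(1) assms(2,3) by simp
      then show False using r k(2) by auto
    next
      case 4
      then have "u (Suc i) < u k" using less k(1) by simp
      then show False using r k(2) by auto
    qed (use r k(2) in auto)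
  qed
qed

text \<open>Links covers in the order sense to the numerical condition in \<open>walk\<close>: the
  interval reduces to \<open>{p, q}\<close>, which is itself a longest chain.\<close>

lemma interval_length_covering:
  fixes p q :: "'a::{finite, order}"
  assumes "p < q" "\<And>r. \<not> (p < r \<and> r < q)"
  shows "interval_length p q = 1"
proof -
  have pq: "{p..q} = {p, q}"
  proof (rule set_eqI)
    show "r \<in> {p..q} \<longleftrightarrow> r \<in> {p, q}" for r
      using assms(1) assms(2)[of r] by (auto simp: order_le_less)
  qed
  have le: "card C - 1 \<le> 1" if "pred_on.chain {p..q} (<) C" for C
  proof -
    have "C \<subseteq> {p, q}" using that pq by (simp add: pred_on.chain_def)
    then have "card C \<le> card {p, q}" by (intro card_mono) auto
    then show ?thesis using assms(1) by simp
  qed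
  have "pred_on.chain {p..q} (<) {p, q}" "card {p, q} - 1 = 1"
    using assms(1) by (simp_all add: pred_on.chain_def less_imp_le)
  then have "1 \<in> {card C - 1 | C. pred_on.chain {p..q} (<) C \<and> C \<noteq> {}}"
    by (intro CollectI exI[of _ "{p, q}"]) simp
  then show ?thesis
    unfolding interval_length_def using le by (intro Max_eqI) auto
qed

lemma chain_enumeration:
  fixes C :: "'a::order set"
  assumes "finite C" "pred_on.chain UNIV (<) C"
  shows "\<exists>u. strict_mono_on {1..card C} u \<and> u ` {1..card C} = C"
  using assms
proof (induction "card C" arbitrary: C)
  case 0
  then show ?case by (auto intro: strict_mono_onI)
next
  case (Suc k)
  \<comment> \<open>A maximal element of a chain is its greatest element; it is split off and placed
    at index \<open>Suc k\<close>.\<close>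
  then obtain z where z: "z \<in> C" "\<And>y. y \<in> C \<Longrightarrow> z \<le> y \<Longrightarrow> z = y"
    using finite_has_maximal[of C] by force
  have less: "y < z" if "y \<in> C" "y \<noteq> z" for y
    using Suc.prems(2) z that unfolding pred_on.chain_def by fastforce
  have "k = card (C - {z})" "pred_on.chain UNIV (<) (C - {z})"
    using Suc z(1) by (auto simp: pred_on.chain_def)
  then obtain u where u: "strict_mono_on {1..k} u" "u ` {1..k} = C - {z}"
    using Suc.hyps(1)[of "C - {z}"] Suc.prems(1) by auto
  define u' where "u' = u(Suc k := z)"
  have "u r < z" if "r \<in> {1..k}" for r
    using less[of "u r"] imageI[OF that, of u] u(2) by blast
  then have "strict_mono_on {1..Suc k} u'"
    by (intro strict_mono_onI) (auto simp: u'_def le_Suc_eq strict_mono_onD[OF u(1)])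
  moreover have "u' ` {1..Suc k} = C"
  proof -
    have "u' ` {1..k} = u ` {1..k}"
      by (intro image_cong) (auto simp: u'_def)
    moreover have "u' (Suc k) = z" by (simp add: u'_def)
    then have "u' ` {1..Suc k} = insert z (u' ` {1..k})"
      by (simp add: atLeastAtMostSuc_conv)
    ultimately show ?thesis
      using u(2) z(1) by (metis insert_Diff)
  qed
  ultimately show ?case
    using Suc.hyps(2) by metis
qed

lemma maximal_chain_through:
  fixes v w :: "'a::{finite, order}"
  assumes "v < w"
  obtains u m i j where "maximal_chain u m" "1 \<le> i" "i < j" "j \<le> m" "u i = v" "u j = w"
proof -
  have "pred_on.chain UNIV (<) {v, w}"
    using assms by (auto simp: pred_on.chain_def)
  \<comment> \<open>There are only finitely many chains, so one containing \<open>v\<close> and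
    \<open>w\<close> is maximal under inclusion.\<close>
  then obtain M where M: "pred_on.chain UNIV (<) M" "{v, w} \<subseteq> M"
    "\<forall>C\<in>{C. pred_on.chain UNIV (<) C}. M \<subseteq> C \<longrightarrow> M = C"
    using finite_has_maximal2[of "{C. pred_on.chain UNIV (<) C}" "{v, w}"]
    by (auto simp only: mem_Collect_eq finite)
  then have "pred_on.maxchain UNIV (<) M"
    unfolding pred_on.maxchain_def by blast
  moreover obtain u where u: "strict_mono_on {1..card M} u" "u ` {1..card M} = M"
    using chain_enumeration[OF finite M(1)] by blast
  ultimately have max: "maximal_chain u (card M)"
    by (simp add: maximal_chain_def)
  have "v \<in> u ` {1..card M}" "w \<in> u ` {1..card M}"
    using u(2) M(2) by simp_all
  then obtain i j where ij: "i \<in> {1..card M}" "u i = v" "j \<in> {1..card M}" "u j = w"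
    by blast
  have "i < j"
  proof (rule ccontr)
    assume "\<not> i < j"
    then show False
      using ij assms strict_mono_onD[OF u(1), of j i] by (cases "i = j") auto
  qed
  then show thesis
    using that[OF max, of i j] ij by simp
qed

section \<open>Maps on pairs preserving composition up to order\<close>

text \<open>Invariant under composition with \<open>prod.swap\<close>, which exchanges the increasing and the
  decreasing case.\<close>

definition triangle_map :: "('a::order \<times> 'a \<Rightarrow> 'b \<times> 'b) \<Rightarrow> bool" where
  "triangle_map T \<longleftrightarrow>
     (\<forall>x y u v. x < y \<longrightarrow> u < v \<longrightarrow> T (x, y) \<noteq> prod.swap (T (u, v))) \<and>
     (\<forall>x y z. x < y \<longrightarrow> y < z \<longrightarrow>
        snd (T (x, y)) = fst (T (y, z)) \<and> T (x, z) = (fst (T (x, y)), snd (T (y, z))) \<or>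
        snd (T (y, z)) = fst (T (x, y)) \<and> T (x, z) = (fst (T (y, z)), snd (T (x, y))))"

text \<open>Here \<open>T\<close> on the chain is induced by a map of points. For
  \<open>prod.swap \<circ> T\<close> in place of \<open>T\<close> the condition reads
  \<open>T (u i, u j) = (f j, f i)\<close>, which is the decreasing case, so one notion covers both
  directions.\<close>

definition chain_image :: "('a \<times> 'a \<Rightarrow> 'b \<times> 'b) \<Rightarrow> (nat \<Rightarrow> 'a) \<Rightarrow> nat \<Rightarrow> (nat \<Rightarrow> 'b) \<Rightarrow> bool" where
  "chain_image T u m f \<longleftrightarrow> (\<forall>i j. 1 \<le> i \<longrightarrow> i < j \<longrightarrow> j \<le> m \<longrightarrow> T (u i, u j) = (f i, f j))"

lemma chain_imageD:
  "chain_image T u m f \<Longrightarrow> 1 \<le> i \<Longrightarrow> i < j \<Longrightarrow> j \<le> m \<Longrightarrow> T (u i, u j) = (f i, f j)"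
  by (simp add: chain_image_def)

lemma triangle_map_asym:
  "triangle_map T \<Longrightarrow> x < y \<Longrightarrow> u < v \<Longrightarrow> T (x, y) \<noteq> prod.swap (T (u, v))"
  by (simp add: triangle_map_def)

lemma triangle_mapE:
  assumes "triangle_map T" "x < y" "y < z"
  obtains "snd (T (x, y)) = fst (T (y, z))" "T (x, z) = (fst (T (x, y)), snd (T (y, z)))"
  | "snd (T (y, z)) = fst (T (x, y))" "T (x, z) = (fst (T (y, z)), snd (T (x, y)))"
  using assms unfolding triangle_map_def by blast

lemma triangle_map_swap:
  assumes "triangle_map T"
  shows "triangle_map (prod.swap \<circ> T)"
  unfolding triangle_map_def
proof (intro conjI allI impI)
  fix x y u v :: 'a assume "x < y" "u < v"
  then show "(prod.swap \<circ> T) (x, y) \<noteq> prod.swap ((prod.swap \<circ> T) (u, v))"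
    using triangle_map_asym[OF assms, of u v x y] by auto
next
  fix x y z :: 'a assume xyz: "x < y" "y < z"
  show "snd ((prod.swap \<circ> T) (x, y)) = fst ((prod.swap \<circ> T) (y, z)) \<and>
      (prod.swap \<circ> T) (x, z) = (fst ((prod.swap \<circ> T) (x, y)), snd ((prod.swap \<circ> T) (y, z))) \<or>
    snd ((prod.swap \<circ> T) (y, z)) = fst ((prod.swap \<circ> T) (x, y)) \<and>
      (prod.swap \<circ> T) (x, z) = (fst ((prod.swap \<circ> T) (y, z)), snd ((prod.swap \<circ> T) (x, y)))"
    by (rule triangle_mapE[OF assms xyz]) auto
qed

text \<open>The image of the new last edge either starts at \<open>f m\<close>, continuing the
  direction so far, or ends at every \<open>f i\<close> with \<open>i < m\<close> at once. The
  latter forces \<open>m = 2\<close>, when a single edge has not yet fixed a direction.\<close>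

lemma chain_image_Suc:
  assumes T: "triangle_map T" and u: "strict_mono_on {1..Suc m} u" and m: "2 \<le> m"
    and f: "chain_image T u m f"
  shows "\<exists>f'. chain_image T u (Suc m) f' \<or> chain_image (prod.swap \<circ> T) u (Suc m) f'"
proof -
  have less: "u i < u j" if "1 \<le> i" "i < j" "j \<le> Suc m" for i j
    using strict_mono_onD[OF u] that by simp
  obtain a b where ab: "T (u m, u (Suc m)) = (a, b)"
    by fastforce
  have step: "f m = a \<and> T (u i, u (Suc m)) = (f i, b) \<or> b = f i \<and> T (u i, u (Suc m)) = (a, f m)"
    if "1 \<le> i" "i < m" for i
  proof -
    have "u i < u m" "u m < u (Suc m)" "T (u i, u m) = (f i, f m)"
      using that less chain_imageD[OF f] m by simp_all
    from triangle_mapE[OF T this(1,2)] this(3) ab show ?thesis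
      by auto
  qed
  show ?thesis
  proof (cases "f m = a")
    case True
    \<comment> \<open>Otherwise the edges from \<open>u i\<close> to \<open>u m\<close> and from
      \<open>u m\<close> to \<open>u (Suc m)\<close> would have opposite images; this leaves only
      the first alternative of \<open>step\<close>.\<close>
    have "b \<noteq> f i" if "1 \<le> i" "i < m" for i
      using triangle_map_asym[OF T less[of m "Suc m"] less[of i m]]
        chain_imageD[OF f, of i m] ab that True by auto
    then have "chain_image T u (Suc m) (f(Suc m := b))"
      unfolding chain_image_def using step chain_imageD[OF f] ab True
      by (auto simp: le_Suc_eq less_Suc_eq)
    then show ?thesis by blast
  next
    case False
    then have b: "b = f i" "T (u i, u (Suc m)) = (a, f m)" if "1 \<le> i" "i < m" for i
      using step that by blast+
    have "m = 2"
    proof (rule ccontr)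
      assume "m \<noteq> 2"
      then have "f 1 = f 2" "T (u 1, u 2) = (f 1, f 2)" "u 1 < u 2"
        using b(1)[of 1] b(1)[of 2] chain_imageD[OF f, of 1 2] less[of 1 2] m by simp_all
      then show False
        using triangle_map_asym[OF T, of "u 1" "u 2" "u 1" "u 2"] by simp
    qed
    \<comment> \<open>With only one earlier edge, \<open>f\<close> may be reread with its two values
      exchanged, and the new edge then continues it for the swapped map.\<close>
    define f' where "f' = (\<lambda>i::nat. if i = 1 then f 2 else if i = 2 then f 1 else a)"
    have "chain_image (prod.swap \<circ> T) u 3 f'"
      unfolding chain_image_def
    proof (intro allI impI)
      fix i j :: nat assume "1 \<le> i" "i < j" "j \<le> 3"
      then consider "i = 1" "j = 2" | "i = 1" "j = 3" | "i = 2" "j = 3" by linarith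
      then show "(prod.swap \<circ> T) (u i, u j) = (f' i, f' j)"
        using chain_imageD[OF f, of 1 2] b[of 1] ab \<open>m = 2\<close>
        by cases (simp_all add: f'_def eval_nat_numeral)
    qed
    then show ?thesis
      using \<open>m = 2\<close> by (auto simp: eval_nat_numeral)
  qed
qed

text \<open>Induction along the chain. Since \<open>triangle_map\<close> is invariant under
  swapping, the same extension step also handles a direction that is already reversed.\<close>

lemma triangle_map_chain:
  assumes "triangle_map T" "2 \<le> m" "strict_mono_on {1..m} u"
  shows "\<exists>f. chain_image T u m f \<or> chain_image (prod.swap \<circ> T) u m f"
  using assms(2,3)
proof (induction m rule: dec_induct)
  case base
  have "chain_image T u 2 (\<lambda>i. if i = 1 then fst (T (u 1, u 2)) else snd (T (u 1, u 2)))"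
    unfolding chain_image_def
  proof (intro allI impI)
    fix i j :: nat assume "1 \<le> i" "i < j" "j \<le> 2"
    then have "i = 1" "j = 2" by linarith+
    then show "T (u i, u j) = (if i = 1 then fst (T (u 1, u 2)) else snd (T (u 1, u 2)),
        if j = 1 then fst (T (u 1, u 2)) else snd (T (u 1, u 2)))"
      by simp
  qed
  then show ?case by blast
next
  case (step m)
  have "strict_mono_on {1..m} u"
    using step.prems by (rule monotone_on_subset) auto
  then obtain f where "chain_image T u m f \<or> chain_image (prod.swap \<circ> T) u m f"
    using step.IH by blast
  then show ?case
  proof
    assume "chain_image T u m f"
    then show ?thesis
      using chain_image_Suc[OF assms(1) step.prems step.hyps(1)] by blast
  next
    assume "chain_image (prod.swap \<circ> T) u m f"
    moreover have "prod.swap \<circ> (prod.swap \<circ> T) = T" by auto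
    ultimately show ?thesis
      using chain_image_Suc[OF triangle_map_swap[OF assms(1)] step.prems step.hyps(1)] by metis
  qed
qed

lemma chain_image_cases:
  assumes "chain_image T u m f \<or> chain_image (prod.swap \<circ> T) u m f" "1 \<le> i" "i < j" "j \<le> m"
  shows "T (u i, u j) = (f i, f j) \<or> T (u i, u j) = (f j, f i)"
  using assms(1)
proof
  assume "chain_image (prod.swap \<circ> T) u m f"
  then have "prod.swap (T (u i, u j)) = (f i, f j)"
    using chain_imageD assms(2-4) by fastforce
  then show ?thesis
    by (cases "T (u i, u j)") auto
qed (use chain_imageD assms(2-4) in blast)

text \<open>Whichever direction \<open>f\<close> follows, images of distinct points are strictly
  comparable, because \<open>T\<close> sends strict pairs to strict pairs. This yields the chain
  property and injectivity together.\<close>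

lemma
  fixes T :: "'a::order \<times> 'a \<Rightarrow> 'b::order \<times> 'b"
  assumes less: "\<And>x y. x < y \<Longrightarrow> fst (T (x, y)) < snd (T (x, y))"
    and u: "strict_mono_on {1..m} u"
    and f: "chain_image T u m f \<or> chain_image (prod.swap \<circ> T) u m f"
  shows chain_image_chain: "pred_on.chain UNIV (<) (f ` {1..m})"
    and card_chain_image: "card (f ` {1..m}) = m"
proof -
  have ordered: "f i < f j \<or> f j < f i" if "1 \<le> i" "i < j" "j \<le> m" for i j
  proof -
    have "u i < u j"
      using strict_mono_onD[OF u] that by simp
    then show ?thesis
      using less[of "u i" "u j"] chain_image_cases[OF f that] by auto
  qed
  have comparable: "f i < f j \<or> f j < f i" if "i \<in> {1..m}" "j \<in> {1..m}" "i \<noteq> j" for i j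
    using ordered[of i j] ordered[of j i] that by (cases "i < j") auto
  have "inj_on f {1..m}"
  proof (rule inj_onI)
    fix i j assume "i \<in> {1..m}" "j \<in> {1..m}" "f i = f j"
    then show "i = j"
      using comparable[of i j] by auto
  qed
  then show "card (f ` {1..m}) = m"
    by (simp add: card_image)
  have "a < b \<or> a = b \<or> b < a" if "a \<in> f ` {1..m}" "b \<in> f ` {1..m}" for a b
    using that comparable by blast
  then show "pred_on.chain UNIV (<) (f ` {1..m})"
    unfolding pred_on.chain_def by blast
qed

text \<open>The monotone image of a maximal chain is maximal: the inverse map carries any larger chain
  to a chain that is larger than the original one.\<close>

lemma triangle_map_maximal_chain:
  fixes T S :: "'a::{finite, order} \<times> 'a \<Rightarrow> 'a \<times> 'a"
  assumes S: "triangle_map S" and less: "\<And>x y. x < y \<Longrightarrow> fst (T (x, y)) < snd (T (x, y))"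
    "\<And>x y. x < y \<Longrightarrow> fst (S (x, y)) < snd (S (x, y))"
    and inv: "\<And>x y. x < y \<Longrightarrow> S (T (x, y)) = (x, y)"
    and u: "maximal_chain u m" "2 \<le> m"
    and f: "chain_image T u m f \<or> chain_image (prod.swap \<circ> T) u m f"
  shows "pred_on.maxchain UNIV (<) (f ` {1..m})"
proof -
  have umono: "strict_mono_on {1..m} u" and umax: "pred_on.maxchain UNIV (<) (u ` {1..m})"
    using u(1) by (simp_all add: maximal_chain_def)
  have u_less: "u i < u j" if "1 \<le> i" "i < j" "j \<le> m" for i j
    using strict_mono_onD[OF umono] that by simp
  have card_f: "card (f ` {1..m}) = m"
    by (rule card_chain_image[OF less(1) umono f])
  have "pred_on.chain UNIV (<) (f ` {1..m})"
    by (rule chain_image_chain[OF less(1) umono f])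
  moreover have "C = f ` {1..m}" if C: "pred_on.chain UNIV (<) C" "f ` {1..m} \<subseteq> C" for C
  proof -
    have "m \<le> card C"
      using card_mono[OF finite C(2)] card_f by simp
    obtain v where v: "strict_mono_on {1..card C} v" "v ` {1..card C} = C"
      using chain_enumeration[OF finite C(1)] by blast
    have v_less: "v a < v b" if "a \<in> {1..card C}" "b \<in> {1..card C}" "a < b" for a b
      using strict_mono_onD[OF v(1)] that by simp
    obtain g where g: "chain_image S v (card C) g \<or> chain_image (prod.swap \<circ> S) v (card C) g"
      using triangle_map_chain[OF S _ v(1)] u(2) \<open>m \<le> card C\<close> by auto
    \<comment> \<open>Each pair from \<open>u\<close> is the image under \<open>S\<close> of a pair
      from \<open>C\<close>, and \<open>g\<close> describes \<open>S\<close> on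
      \<open>C\<close>.\<close>
    have pair: "u i \<in> g ` {1..card C} \<and> u j \<in> g ` {1..card C}"
      if ij: "1 \<le> i" "i < j" "j \<le> m" for i j
    proof -
      obtain p q where pq: "T (u i, u j) = (p, q)" "p < q" "S (p, q) = (u i, u j)"
        using less(1)[OF u_less[OF ij]] inv[OF u_less[OF ij]] by (cases "T (u i, u j)") auto
      then have "p \<in> C" "q \<in> C"
        using chain_image_cases[OF f ij] C(2) ij by auto
      then obtain a b where ab: "a \<in> {1..card C}" "b \<in> {1..card C}" "p = v a" "q = v b"
        using v(2) by blast
      have "a < b"
      proof (rule ccontr)
        assume "\<not> a < b"
        then show False
          using v_less[of b a] ab pq(2) by (cases "a = b") auto
      qed
      then show ?thesis
        using chain_image_cases[OF g, of a b] ab pq(3) by auto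
    qed
    have "u ` {1..m} \<subseteq> g ` {1..card C}"
    proof (rule image_subsetI)
      fix i assume "i \<in> {1..m}"
      then show "u i \<in> g ` {1..card C}"
        using pair[of i "Suc i"] pair[of 1 i] u(2) by (cases "i = m") auto
    qed
    moreover have "pred_on.chain UNIV (<) (g ` {1..card C})"
      by (rule chain_image_chain[OF less(2) v(1) g])
    ultimately have "u ` {1..m} = g ` {1..card C}"
      using umax unfolding pred_on.maxchain_def by blast
    moreover have "card (u ` {1..m}) = m"
      using card_image[OF strict_mono_on_imp_inj_on[OF umono]] by simp
    \<comment> \<open>Maximality of \<open>u\<close> made the two enumerated chains equal as sets,
      so comparing sizes leaves no room for an extra element of \<open>C\<close>.\<close>
    ultimately have "card C = card (f ` {1..m})"
      using card_chain_image[OF less(2) v(1) g] card_f by simp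
    then show ?thesis
      using card_subset_eq[OF finite C(2)] by simp
  qed
  ultimately show ?thesis
    unfolding pred_on.maxchain_def by blast
qed

section \<open>The parameters of a pure commutativity preserver\<close>

lemma commutator_add_diff:
  "commutator (a + b) f = commutator a f + commutator b (f :: 'r::ring)"
  "commutator f (a - b) = commutator f a - commutator f (b :: 'r::ring)"
  by (simp_all add: commutator_def algebra_simps)

text \<open>\<open>T\<close> is \<open>\<theta>\<close> read on pairs of endpoints, so that
  arguments concern points of the poset instead of matrix units. Purity is built into
  \<open>\<phi>_munit\<close>, which has no diagonal summand.\<close>

locale pure_preserver =
  fixes \<phi> \<theta> :: "('a::{finite, order}, 'k::field) incidence \<Rightarrow> ('a, 'k) incidence"
    and T :: "'a \<times> 'a \<Rightarrow> 'a \<times> 'a" and \<sigma> :: "'a \<times> 'a \<Rightarrow> 'k"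
  assumes linear: "Vector_Spaces.linear iscale iscale \<phi>"
    and bij: "bij \<phi>"
    and commutator_eq_0_iff: "\<And>a b. commutator (\<phi> a) (\<phi> b) = 0 \<longleftrightarrow> commutator a b = 0"
    and diagonal: "\<And>d. d \<in> diagonal \<Longrightarrow> \<phi> d \<in> diagonal"
    and T_bij: "bij_betw T strict_pairs strict_pairs"
    and \<sigma>_nonzero: "\<And>x y. x < y \<Longrightarrow> \<sigma> (x, y) \<noteq> 0"
    and \<theta>_munit: "\<And>x y p q. x < y \<Longrightarrow> T (x, y) = (p, q) \<Longrightarrow> \<theta> (munit x y) = munit p q"
    and \<phi>_munit: "\<And>x y. x < y \<Longrightarrow> \<phi> (munit x y) = iscale (\<sigma> (x, y)) (\<theta> (munit x y))"
begin

definition diag_entry :: "'a \<Rightarrow> 'a \<Rightarrow> 'k" where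
  "diag_entry z p = entry (\<phi> (munit z z)) p p"

text \<open>The candidate for \<open>c\<close>. The sign matches \<open>step_contribution\<close>,
  which is \<open>- c (v, w)\<close> at \<open>z = v\<close> on an upward step: the lower entry
  minus the upper one.\<close>

definition gap :: "'a \<times> 'a \<Rightarrow> 'k" where
  "gap = (\<lambda>(v, w). diag_entry v (fst (T (v, w))) - diag_entry v (snd (T (v, w))))"

section \<open>Linked pairs and differences of diagonal entries\<close>

lemma T_less: "x < y \<Longrightarrow> fst (T (x, y)) < snd (T (x, y))"
  using bij_betwE[OF T_bij] by (force simp: strict_pairs_def)

lemma T_surj:
  assumes "p < q"
  obtains v w where "v < w" "T (v, w) = (p, q)"
proof -
  have "(p, q) \<in> T ` strict_pairs"
    using assms T_bij by (simp add: bij_betw_def strict_pairs_def)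
  then show ?thesis
    using that by (auto simp: strict_pairs_def)
qed

text \<open>Two strict units fail to commute exactly when they compose in one of the two orders, and
  \<open>\<phi>\<close> preserves and reflects commutation. The order of composition may change,
  which is the source of the increasing and decreasing cases.\<close>

lemma T_linked_iff:
  assumes "x < y" "u < v" "T (x, y) = (p, q)" "T (u, v) = (r, s)"
  shows "(q = r \<or> s = p) \<longleftrightarrow> (y = u \<or> v = x)"
proof -
  have pq: "p < q" "r < s"
    using T_less[OF assms(1)] T_less[OF assms(2)] assms(3,4) by simp_all
  have "commutator (\<phi> (munit x y)) (\<phi> (munit u v)) =
      iscale (\<sigma> (x, y) * \<sigma> (u, v)) (commutator (munit p q) (munit r s))"
    using assms by (simp add: \<phi>_munit \<theta>_munit commutator_iscale_iscale)
  then have "commutator (munit x y :: ('a, 'k) incidence) (munit u v) = 0 \<longleftrightarrow>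
      commutator (munit p q :: ('a, 'k) incidence) (munit r s) = 0"
    using commutator_eq_0_iff[of "munit x y" "munit u v"] \<sigma>_nonzero assms(1,2) by simp
  then show ?thesis
    using commutator_munit_munit_eq_0_iff[OF assms(1,2), where 'k='k]
      commutator_munit_munit_eq_0_iff[OF pq, where 'k='k] by auto
qed

lemma \<phi>_diagonal: "\<phi> (munit z z) \<in> diagonal"
  by (intro diagonal munit_diagonal)

lemma diag_entry_eq_iff:
  assumes "v < w" "T (v, w) = (p, q)"
  shows "diag_entry z p = diag_entry z q \<longleftrightarrow> z \<noteq> v \<and> z \<noteq> w"
proof -
  have "p < q"
    using T_less[OF assms(1)] assms(2) by simp
  have "commutator (\<phi> (munit z z)) (\<phi> (munit v w)) =
      iscale (\<sigma> (v, w)) (commutator (\<phi> (munit z z)) (munit p q))"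
    using commutator_iscale_iscale[of 1] assms by (simp add: \<phi>_munit \<theta>_munit)
  then have "commutator (munit z z :: ('a, 'k) incidence) (munit v w) = 0 \<longleftrightarrow>
      commutator (\<phi> (munit z z)) (munit p q) = 0"
    using commutator_eq_0_iff[of "munit z z" "munit v w"] \<sigma>_nonzero assms(1) by simp
  also have "\<dots> \<longleftrightarrow> diag_entry z p = diag_entry z q"
    using commutator_diagonal_munit_eq_0_iff[OF \<phi>_diagonal] \<open>p < q\<close> by (simp add: diag_entry_def)
  also have "commutator (munit z z :: ('a, 'k) incidence) (munit v w) = 0 \<longleftrightarrow> z \<noteq> v \<and> z \<noteq> w"
    using commutator_diagonal_munit_eq_0_iff[OF munit_diagonal, of v w z] assms(1)
      less_imp_le[OF assms(1)]
    by (auto simp: munit.rep_eq split: if_splits)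
  finally show ?thesis by simp
qed

lemma entry_\<phi>_one: "entry (\<phi> 1) p p = (\<Sum>z\<in>UNIV. diag_entry z p)"
  by (simp add: one_incidence_eq_sum diag_entry_def entry_sum incidence_pair.linear_sum[OF linear])

lemma \<phi>_one_diagonal: "\<phi> 1 \<in> diagonal"
  unfolding one_incidence_eq_sum
  by (rule diagonal) (simp add: diagonal_def incidence.span_sum incidence.span_base)

text \<open>The image of the identity commutes with every image, and by surjectivity every matrix
  unit is an image.\<close>

lemma sum_diag_entry_eq:
  assumes "p < q"
  shows "(\<Sum>z\<in>UNIV. diag_entry z p) = (\<Sum>z\<in>UNIV. diag_entry z q)"
proof -
  obtain b where b: "\<phi> b = munit p q"
    using bij by (metis bij_pointE)
  have "commutator (\<phi> 1) (\<phi> b) = 0"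
    unfolding commutator_eq_0_iff by (simp add: commutator_def)
  then show ?thesis
    using commutator_diagonal_munit_eq_0_iff[OF \<phi>_one_diagonal, of p q] assms
    by (simp add: b entry_\<phi>_one)
qed

lemma
  assumes vw: "v < w" and T: "T (v, w) = (p, q)"
  shows gap_left: "diag_entry v p - diag_entry v q = gap (v, w)"
    and gap_right: "diag_entry w q - diag_entry w p = gap (v, w)"
    and gap_nonzero: "gap (v, w) \<noteq> 0"
proof -
  show left: "diag_entry v p - diag_entry v q = gap (v, w)"
    by (simp add: gap_def T)
  show "gap (v, w) \<noteq> 0"
    using diag_entry_eq_iff[OF assms, of v] unfolding left[symmetric] by simp
  have "p < q"
    using T_less[OF vw] T by simp
  then have "0 = (\<Sum>z\<in>UNIV. diag_entry z p - diag_entry z q)"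
    by (simp add: sum_subtractf sum_diag_entry_eq)
  \<comment> \<open>Only \<open>e_v\<close> and \<open>e_w\<close> have images that differ at
    \<open>p\<close> and \<open>q\<close>, so their two differences must cancel.\<close>
  also have "\<dots> = (\<Sum>z\<in>{v, w}. diag_entry z p - diag_entry z q)"
    using diag_entry_eq_iff[OF assms] by (intro sum.mono_neutral_right) auto
  finally show "diag_entry w q - diag_entry w p = gap (v, w)"
    using vw by (simp add: left[symmetric] algebra_simps)
qed

text \<open>Only the endpoints of the preimage of \<open>(p, s)\<close> have images whose diagonals
  separate \<open>p\<close> from \<open>s\<close>. Two distinct points doing so are therefore those
  endpoints, and the order tells which is which.\<close>

lemma T_composite_pair:
  assumes xyz: "x < y" "y < z" and ps: "p < s"
    and x: "diag_entry x p \<noteq> diag_entry x s" and z: "diag_entry z p \<noteq> diag_entry z s"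
  shows "T (x, z) = (p, s)"
proof -
  obtain v w where vw: "v < w" "T (v, w) = (p, s)"
    using T_surj[OF ps] by blast
  have "x = v \<or> x = w" "z = v \<or> z = w"
    using diag_entry_eq_iff[OF vw] x z by blast+
  moreover have "x < z" using xyz by simp
  ultimately show ?thesis
    using vw by auto
qed

text \<open>If \<open>q = r\<close>, then \<open>\<phi>(e_x)\<close> does not change from
  \<open>r\<close> to \<open>s\<close>, so its difference across \<open>(p, s)\<close> is the one
  across \<open>(p, q)\<close>; likewise for \<open>z\<close> across \<open>(r, s)\<close>. Both are
  nonzero, which identifies the preimage of \<open>(p, s)\<close> and equates the gaps. The case
  \<open>s = p\<close> is symmetric.\<close>

lemma T_triangle:
  assumes xyz: "x < y" "y < z"
    and T: "T (x, y) = (p, q)" "T (y, z) = (r, s)"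
  shows "q = r \<and> T (x, z) = (p, s) \<or> s = p \<and> T (x, z) = (r, q)"
    and "gap (x, y) = gap (x, z)" "gap (y, z) = gap (x, z)"
proof -
  have xz: "x < z" "x \<noteq> y" "x \<noteq> z" "y \<noteq> z" using xyz by auto
  have less: "p < q" "r < s"
    using T_less[OF xyz(1)] T_less[OF xyz(2)] T by simp_all
  have outer: "diag_entry x r = diag_entry x s" "diag_entry z p = diag_entry z q"
    using diag_entry_eq_iff[OF xyz(2) T(2)] diag_entry_eq_iff[OF xyz(1) T(1)] xz by simp_all
  have differ: "diag_entry x p \<noteq> diag_entry x q" "diag_entry z r \<noteq> diag_entry z s"
    using diag_entry_eq_iff[OF xyz(2) T(2), of z] diag_entry_eq_iff[OF xyz(1) T(1), of x] by simp_all
  note gaps = gap_left[OF xyz(1) T(1)] gap_right[OF xyz(2) T(2)]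
  consider (inc) "q = r" | (dec) "s = p"
    using T_linked_iff[OF xyz T] by auto
  then have "(q = r \<and> T (x, z) = (p, s) \<or> s = p \<and> T (x, z) = (r, q)) \<and>
    gap (x, y) = gap (x, z) \<and> gap (y, z) = gap (x, z)"
  proof cases
    case inc
    then have "T (x, z) = (p, s)"
      using outer differ less by (intro T_composite_pair[OF xyz]) auto
    then show ?thesis
      using inc gaps gap_left[OF xz(1), of p s] gap_right[OF xz(1), of p s] outer
      by simp
  next
    case dec
    then have "T (x, z) = (r, q)"
      using outer differ less by (intro T_composite_pair[OF xyz]) auto
    then show ?thesis
      using dec gaps gap_left[OF xz(1), of r q] gap_right[OF xz(1), of r q] outer
      by simp
  qed
  then show "q = r \<and> T (x, z) = (p, s) \<or> s = p \<and> T (x, z) = (r, q)"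
    "gap (x, y) = gap (x, z)" "gap (y, z) = gap (x, z)"
    by blast+
qed

lemma gap_triangle:
  assumes "x < y" "y < z"
  shows "gap (x, y) = gap (x, z)" "gap (y, z) = gap (x, z)"
  using T_triangle(2,3)[OF assms prod.collapse[symmetric] prod.collapse[symmetric]] .

lemma gap_constant_on_maximal_chains: "constant_on_maximal_chains gap"
  unfolding constant_on_maximal_chains_def
proof (intro allI impI)
  fix u :: "nat \<Rightarrow> 'a" and m i j
  assume u: "maximal_chain u m" and ij: "1 \<le> i \<and> i < j \<and> j \<le> m"
  have less: "u k < u l" if "1 \<le> k" "k < l" "l \<le> m" for k l
    using u strict_mono_onD that unfolding maximal_chain_def by fastforce
  \<comment> \<open>The upper endpoint is moved to the top of the chain first, then the lower one to
    the bottom, each by one triangle.\<close>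
  have "gap (u i, u j) = gap (u i, u m)"
    using gap_triangle(1)[OF less[of i j] less[of j m]] ij by (cases "j = m") simp_all
  also have "\<dots> = gap (u 1, u m)"
    using gap_triangle(2)[OF less[of 1 i] less[of i m]] ij by (cases "i = 1") simp_all
  finally show "gap (u i, u j) = gap (u 1, u m)" .
qed

text \<open>Turns the product conditions in \<open>compatible\<close> into equations between
  endpoints; a vanishing product is excluded because the left-hand side is a nonzero matrix
  unit.\<close>

lemma \<theta>_times_eq_iff:
  assumes "x < y" "u < v" "a < b" "T (x, y) = (p, q)" "T (u, v) = (r, s)" "T (a, b) = (k, l)"
  shows "\<theta> (munit a b) = \<theta> (munit x y) * \<theta> (munit u v) \<longleftrightarrow> q = r \<and> k = p \<and> l = s"
proof -
  have "p < q" "r < s" "k < l"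
    using T_less[OF assms(1)] T_less[OF assms(2)] T_less[OF assms(3)] assms(4-6) by simp_all
  then show ?thesis
    using assms munit_neq_0[of k l, where 'k='k]
    by (simp add: \<theta>_munit munit_times_munit munit_inject)
qed

text \<open>The elements \<open>e\<^sub>x + e\<^sub>x\<^sub>y\<close> and \<open>e\<^sub>y\<^sub>z - e\<^sub>x\<^sub>z\<close> commute, and the commutator of their images is a
  multiple of \<open>\<theta>(e\<^sub>x\<^sub>z)\<close>, whose coefficient must vanish.\<close>

lemma compatible_gap: "compatible \<theta> gap \<sigma>"
  unfolding compatible_def
proof (intro allI impI)
  fix x y z :: 'a assume xyz': "x < y \<and> y < z"
  then have xyz: "x < y" "y < z" "x < z" by auto
  then have neq: "y \<noteq> x" "z \<noteq> y" "z \<noteq> x" by auto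
  obtain p q r s k l where T: "T (x, y) = (p, q)" "T (y, z) = (r, s)" "T (x, z) = (k, l)"
    by (metis surj_pair)
  have less: "p < q" "r < s" "k < l"
    using T_less[OF xyz(1)] T_less[OF xyz(2)] T_less[OF xyz(3)] T by simp_all
  \<comment> \<open>The brackets \<open>[e_x, e_xz]\<close> and \<open>[e_xy, e_yz]\<close> both
    equal \<open>e_xz\<close> and cancel; the two mixed ones vanish.\<close>
  have "commutator (munit x x + munit x y) (munit y z - munit x z :: ('a, 'k) incidence) = 0"
    using xyz neq by (simp add: less_imp_le less_imp_neq commutator_def distrib_left distrib_right
        right_diff_distrib left_diff_distrib munit_times_munit)
  then have "commutator (\<phi> (munit x x + munit x y)) (\<phi> (munit y z - munit x z)) = 0"
    by (simp only: commutator_eq_0_iff)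
  then have "commutator (\<phi> (munit x x) + \<phi> (munit x y)) (\<phi> (munit y z) - \<phi> (munit x z)) = 0"
    by (simp only: incidence_pair.linear_add[OF linear] incidence_pair.linear_diff[OF linear])
  moreover have "commutator (\<phi> (munit x x)) (\<phi> (munit y z)) = 0"
    "commutator (\<phi> (munit x y)) (\<phi> (munit x z)) = 0"
    unfolding commutator_eq_0_iff using xyz neq
    by (simp_all add: less_imp_le less_imp_neq commutator_def munit_times_munit)
  ultimately have eq: "commutator (\<phi> (munit x x)) (\<phi> (munit x z)) =
      commutator (\<phi> (munit x y)) (\<phi> (munit y z))"
    by (simp add: commutator_add_diff)
  have "commutator (\<phi> (munit x x)) (\<phi> (munit x z)) =
      iscale (\<sigma> (x, z)) (commutator (\<phi> (munit x x)) (munit k l))"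
    using commutator_iscale_iscale[of 1] xyz(3) T(3) by (simp add: \<phi>_munit \<theta>_munit)
  also have "\<dots> = iscale (gap (x, z) * \<sigma> (x, z)) (munit k l)"
    using gap_left[OF xyz(3) T(3)] less(3)
    by (simp add: commutator_diagonal_munit[OF \<phi>_diagonal] diag_entry_def mult.commute)
  finally have "iscale (gap (x, z) * \<sigma> (x, z)) (munit k l) =
      iscale (\<sigma> (x, y) * \<sigma> (y, z)) (commutator (munit p q) (munit r s))"
    unfolding eq using xyz T by (simp add: \<phi>_munit \<theta>_munit commutator_iscale_iscale)
  then have eq': "entry (iscale (gap (x, z) * \<sigma> (x, z)) (munit k l)) k l =
      entry (iscale (\<sigma> (x, y) * \<sigma> (y, z)) (commutator (munit p q) (munit r s))) k l"
    by simp
  have inc: "gap (x, z) * \<sigma> (x, z) = \<sigma> (x, y) * \<sigma> (y, z)" if "q = r" "k = p" "l = s"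
  proof -
    have "p < s" "s \<noteq> p" using less that by auto
    then show ?thesis
      using eq' less that by (simp add: less_imp_le commutator_def munit_times_munit entry_simps)
  qed
  \<comment> \<open>Now only the second product of the bracket survives, which produces the minus
    sign.\<close>
  have dec: "gap (x, z) * \<sigma> (x, z) = - (\<sigma> (x, y) * \<sigma> (y, z))" if "s = p" "k = r" "l = q"
  proof -
    have "r < q" "q \<noteq> r" using less that by auto
    then show ?thesis
      using eq' less that by (simp add: less_imp_le commutator_def munit_times_munit entry_simps)
  qed
  show "(\<theta> (munit x z) = \<theta> (munit x y) * \<theta> (munit y z) \<longrightarrow>
      gap (x, z) * \<sigma> (x, z) = \<sigma> (x, y) * \<sigma> (y, z)) \<and>
    (\<theta> (munit x z) = \<theta> (munit y z) * \<theta> (munit x y) \<longrightarrow>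
      gap (x, z) * \<sigma> (x, z) = - (\<sigma> (x, y) * \<sigma> (y, z)))"
    unfolding \<theta>_times_eq_iff[OF xyz T] \<theta>_times_eq_iff[OF xyz(2,1,3) T(2,1,3)]
    using inc dec by blast
qed

section \<open>Monotonicity on maximal chains\<close>

lemma triangle_map_T: "triangle_map T"
  unfolding triangle_map_def
proof (intro conjI allI impI)
  fix x y u v :: 'a assume "x < y" "u < v"
  then show "T (x, y) \<noteq> prod.swap (T (u, v))"
    using T_less[of x y] T_less[of u v] by (auto simp: prod.swap_def)
next
  fix x y z :: 'a assume "x < y" "y < z"
  from T_triangle(1)[OF this prod.collapse[symmetric] prod.collapse[symmetric]]
  show "snd (T (x, y)) = fst (T (y, z)) \<and> T (x, z) = (fst (T (x, y)), snd (T (y, z))) \<or>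
    snd (T (y, z)) = fst (T (x, y)) \<and> T (x, z) = (fst (T (y, z)), snd (T (x, y)))" .
qed

definition T_inv :: "'a \<times> 'a \<Rightarrow> 'a \<times> 'a" where
  "T_inv = the_inv_into strict_pairs T"

lemma T_inv_T: "x < y \<Longrightarrow> T_inv (T (x, y)) = (x, y)"
  unfolding T_inv_def by (intro the_inv_into_f_f bij_betw_imp_inj_on[OF T_bij]) (simp add: strict_pairs_def)

lemma T_inv_less: "p < q \<Longrightarrow> fst (T_inv (p, q)) < snd (T_inv (p, q))"
  by (metis T_surj T_inv_T fst_conv snd_conv)

text \<open>Since \<open>T_linked_iff\<close> is an equivalence, consecutive image pairs come from
  consecutive pairs, and \<open>T_triangle\<close> can be read backwards. This is what lets
  maximality pass to the image of a chain.\<close>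

lemma triangle_map_T_inv: "triangle_map T_inv"
  unfolding triangle_map_def
proof (intro conjI allI impI)
  fix x y u v :: 'a assume "x < y" "u < v"
  then show "T_inv (x, y) \<noteq> prod.swap (T_inv (u, v))"
    using T_inv_less[of x y] T_inv_less[of u v] by (auto simp: prod.swap_def)
next
  fix p q s :: 'a assume pqs: "p < q" "q < s"
  obtain x y where xy: "x < y" "T (x, y) = (p, q)" using T_surj[OF pqs(1)] .
  obtain u v where uv: "u < v" "T (u, v) = (q, s)" using T_surj[OF pqs(2)] .
  have inv: "T_inv (p, q) = (x, y)" "T_inv (q, s) = (u, v)"
    using T_inv_T xy uv by metis+
  have "y = u \<or> v = x"
    using T_linked_iff[OF xy(1) uv(1) xy(2) uv(2)] by simp
  then have "y = u \<and> T_inv (p, s) = (x, v) \<or> v = x \<and> T_inv (p, s) = (u, y)"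
  proof
    assume "y = u"
    then have "T (x, v) = (p, s)" "x < v"
      using T_triangle(1)[OF xy(1) _ xy(2), of v q s] uv xy pqs by auto
    then show ?thesis using \<open>y = u\<close> T_inv_T by metis
  next
    assume "v = x"
    then have "T (u, y) = (p, s)" "u < y"
      using T_triangle(1)[OF uv(1) _ uv(2), of y p q] uv xy pqs by auto
    then show ?thesis using \<open>v = x\<close> T_inv_T by metis
  qed
  then show "snd (T_inv (p, q)) = fst (T_inv (q, s)) \<and>
      T_inv (p, s) = (fst (T_inv (p, q)), snd (T_inv (q, s))) \<or>
    snd (T_inv (q, s)) = fst (T_inv (p, q)) \<and>
      T_inv (p, s) = (fst (T_inv (q, s)), snd (T_inv (p, q)))"
    by (simp add: inv)
qed

lemma monotone: "monotone_on_maximal_chains \<theta>"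
  unfolding monotone_on_maximal_chains_def
proof (intro allI impI)
  fix u :: "nat \<Rightarrow> 'a" and m
  assume u: "maximal_chain u m"
  then have umono: "strict_mono_on {1..m} u"
    by (simp add: maximal_chain_def)
  have u_less: "u i < u j" if "1 \<le> i" "i < j" "j \<le> m" for i j
    using strict_mono_onD[OF umono] that by simp
  show "increasing_on_chain \<theta> u m \<or> decreasing_on_chain \<theta> u m"
  proof (cases "2 \<le> m")
    \<comment> \<open>Such a chain contains no strict pair, so \<open>u\<close> itself is a vacuous
      witness.\<close>
    case False
    then show ?thesis
      using u unfolding increasing_on_chain_def by (intro disjI1 exI[of _ u]) auto
  next
    case True
    obtain f where f: "chain_image T u m f \<or> chain_image (prod.swap \<circ> T) u m f"
      using triangle_map_chain[OF triangle_map_T True umono] by blast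
    have max: "pred_on.maxchain UNIV (<) (f ` {1..m})"
      by (rule triangle_map_maximal_chain[OF triangle_map_T_inv T_less T_inv_less T_inv_T u True f])
    from f show ?thesis
    proof
      assume f: "chain_image T u m f"
      have "strict_mono_on {1..m} f"
        using T_less[OF u_less] chain_imageD[OF f] by (intro strict_mono_onI) fastforce
      then have "increasing_on_chain \<theta> u m"
        unfolding increasing_on_chain_def using max \<theta>_munit[OF u_less chain_imageD[OF f]]
        by (intro exI[of _ f]) (simp add: maximal_chain_def)
      then show ?thesis ..
    next
      assume f: "chain_image (prod.swap \<circ> T) u m f"
      have T: "T (u i, u j) = (f j, f i)" if "1 \<le> i" "i < j" "j \<le> m" for i j
        using chain_imageD[OF f that] by (cases "T (u i, u j)") simp
      \<comment> \<open>Here \<open>f\<close> lists the image from the top down, so it is reversed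
        to obtain an increasing enumeration.\<close>
      have "strict_mono_on {1..m} (\<lambda>i. f (m - i + 1))"
      proof (rule strict_mono_onI)
        fix i j assume "i \<in> {1..m}" "j \<in> {1..m}" "i < j"
        then have "1 \<le> m - j + 1" "m - j + 1 < m - i + 1" "m - i + 1 \<le> m" by auto
        from T_less[OF u_less[OF this]] T[OF this] show "f (m - i + 1) < f (m - j + 1)"
          by simp
      qed
      moreover have "(\<lambda>i. f (m - i + 1)) ` {1..m} = f ` {1..m}"
      proof -
        have "(\<lambda>i. m - i + 1) ` {1..m} = {1..m}"
        proof (intro equalityI subsetI)
          fix i assume "i \<in> {1..m}"
          then have "i = m - (m - i + 1) + 1" "m - i + 1 \<in> {1..m}" by auto
          then show "i \<in> (\<lambda>i. m - i + 1) ` {1..m}" by (rule image_eqI)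
        qed auto
        then show ?thesis by (metis image_image)
      qed
      ultimately have "maximal_chain (\<lambda>i. f (m - i + 1)) m"
        using max by (simp add: maximal_chain_def)
      \<comment> \<open>The definition of a decreasing map reverses indices again;
        \<open>i \<mapsto> m - i + 1\<close> is an involution on \<open>{1..m}\<close>.\<close>
      moreover have "\<theta> (munit (u i) (u j)) = munit (f (m - (m - j + 1) + 1)) (f (m - (m - i + 1) + 1))"
        if "1 \<le> i" "i < j" "j \<le> m" for i j
      proof -
        have "m - (m - j + 1) + 1 = j" "m - (m - i + 1) + 1 = i" using that by auto
        then show ?thesis using \<theta>_munit[OF u_less[OF that] T[OF that]] by simp
      qed
      ultimately have "decreasing_on_chain \<theta> u m"
        unfolding decreasing_on_chain_def by blast
      then show ?thesis ..
    qed
  qed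
qed

end

section \<open>Representation and uniqueness\<close>

lemma diagonal_eq_sum:
  fixes d :: "('a::{finite, order}, 'k::field) incidence"
  assumes "d \<in> diagonal"
  shows "d = (\<Sum>v\<in>UNIV. iscale (entry d v v) (munit v v))"
proof (rule incidence_eqI)
  fix u v
  have "(\<Sum>w\<in>UNIV. entry (iscale (entry d w w) (munit w w)) u v) =
      (\<Sum>w\<in>UNIV. if w = u then if u = v then entry d u u else 0 else 0)"
    by (intro sum.cong refl) (auto simp: entry_simps)
  then show "entry d u v = entry (\<Sum>w\<in>UNIV. iscale (entry d w w) (munit w w)) u v"
    using entry_diagonal[OF assms, of u v] by (auto simp: entry_sum)
qed

lemma walk_comparable: "walk u m \<Longrightarrow> i < m \<Longrightarrow> u i \<le> u (Suc i) \<or> u (Suc i) \<le> u i"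
  unfolding walk_def by blast

lemma walk_invariant:
  assumes "\<And>p q. p < q \<Longrightarrow> F p = F q" "walk u m"
  shows "F (u m) = F (u 0)"
proof -
  have "F (u i) = F (u 0)" if "i \<le> m" for i
    using that
  proof (induction i)
    case (Suc i)
    then have "u i \<le> u (Suc i) \<or> u (Suc i) \<le> u i"
      using walk_comparable[OF assms(2)] by simp
    then have "F (u (Suc i)) = F (u i)"
      using assms(1) by (metis order_le_less)
    then show ?case
      using Suc by simp
  qed simp
  then show ?thesis by blast
qed

section \<open>Admissibility and the formula for \<open>tau\<close>\<close>

context pure_preserver
begin

lemma T_eq_if_\<theta>_eq:
  assumes "v < w" "\<theta> (munit v w) = munit p q"
  shows "T (v, w) = (p, q)"
proof (cases "T (v, w)")
  case (Pair a b)
  then have "a < b" using T_less[OF assms(1)] by simp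
  then show ?thesis
    using munit_inject[of a b p q, where 'k='k] \<theta>_munit[OF assms(1) Pair] assms(2) Pair by simp
qed

text \<open>For an upward step the three cases in the definition of the contribution are
  \<open>gap_left\<close>, \<open>gap_right\<close> and the vanishing of all other differences; a
  downward step follows by antisymmetry.\<close>

lemma step_contribution_eq:
  assumes \<theta>_bij: "bij_betw \<theta> strict_units strict_units"
    and c: "\<forall>v w. v < w \<longrightarrow> c (v, w) = gap (v, w)" and "p \<le> q \<or> q \<le> p"
  shows "step_contribution \<theta> c p q z = diag_entry z q - diag_entry z p"
proof -
  have less: "step_contribution \<theta> c p q z = diag_entry z q - diag_entry z p" if pq: "p < q" for p q
  proof -
    obtain v w where vw: "preimage_pair \<theta> p q = (v, w)" "v < w" "\<theta> (munit v w) = munit p q"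
      by (rule preimage_pair[OF \<theta>_bij pq])
    have T: "T (v, w) = (p, q)"
      by (rule T_eq_if_\<theta>_eq[OF vw(2,3)])
    have "\<not> q < p" "v \<noteq> w" using pq vw(2) by auto
    then have step: "step_contribution \<theta> c p q z =
        (if z = v then - gap (v, w) else if z = w then gap (v, w) else 0)"
      using pq by (simp add: step_contribution_def vw(1) c[rule_format, OF vw(2)])
    consider "z = v" | "z = w" | "z \<noteq> v" "z \<noteq> w" by blast
    then show ?thesis
    proof cases
      case 1
      then show ?thesis unfolding step by (simp add: gap_left[OF vw(2) T, symmetric])
    next
      case 2
      then show ?thesis unfolding step using \<open>v \<noteq> w\<close> by (simp add: gap_right[OF vw(2) T])
    next
      case 3
      then show ?thesis unfolding step using diag_entry_eq_iff[OF vw(2) T, of z] by simp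
    qed
  qed
  consider "p < q" | "q < p" | "p = q"
    using assms(3) by fastforce
  then show ?thesis
  proof cases
    case 2
    then show ?thesis
      using less[of q p] step_contribution_swap[OF \<theta>_bij, of c p q z] by simp
  next
    case 3
    then show ?thesis by (simp add: step_contribution_def split: prod.splits)
  qed (rule less)
qed

text \<open>The contributions telescope, so the sum depends on the endpoints of the walk
  alone.\<close>

lemma sum_step_contribution_eq:
  assumes "bij_betw \<theta> strict_units strict_units"
    and "\<forall>v w. v < w \<longrightarrow> c (v, w) = gap (v, w)" and "walk u m"
  shows "(\<Sum>j<m. step_contribution \<theta> c (u j) (u (Suc j)) z) = diag_entry z (u m) - diag_entry z (u 0)"
proof -
  have "(\<Sum>j<m. step_contribution \<theta> c (u j) (u (Suc j)) z) =
      (\<Sum>j<m. diag_entry z (u (Suc j)) - diag_entry z (u j))"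
    using walk_comparable[OF assms(3)] by (intro sum.cong refl step_contribution_eq assms(1,2)) auto
  then show ?thesis
    using sum_lessThan_telescope[of "\<lambda>j. diag_entry z (u j)" m] by simp
qed

text \<open>On a closed walk the telescoped sum is zero, and admissibility is this statement after
  sorting the contributions. Agreement of \<open>c\<close> with \<open>gap\<close> is asked on
  strict pairs only, so that a restricted \<open>c\<close> qualifies.\<close>

lemma admissible_gap:
  assumes "bij_betw \<theta> strict_units strict_units" "\<forall>v w. v < w \<longrightarrow> c (v, w) = gap (v, w)"
  shows "admissible \<theta> c"
  unfolding admissible_def closed_walk_def
proof (intro allI impI)
  fix u :: "nat \<Rightarrow> 'a" and m z
  assume "walk u m \<and> u m = u 0"
  then show "s_plus \<theta> c u m z - s_minus \<theta> c u m z = t_plus \<theta> c u m z - t_minus \<theta> c u m z"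
    using sum_step_contribution_eq[OF assms, where u=u and m=m and z=z]
      sum_step_contribution[OF assms(1), where u=u and m=m and z=z and c=c]
    by simp
qed

text \<open>The sum is a diagonal entry of \<open>\<phi> 1\<close>, and connectedness makes all
  these entries equal. If they were zero, \<open>\<phi> 1\<close> would vanish, against
  injectivity.\<close>

lemma sum_diag_entry_nonzero:
  assumes "connected_poset TYPE('a)"
  shows "(\<Sum>z\<in>UNIV. diag_entry z p) \<noteq> 0"
proof
  assume zero: "(\<Sum>z\<in>UNIV. diag_entry z p) = 0"
  have "entry (\<phi> 1) q q = 0" for q
  proof -
    obtain u m where "walk_from_to p q u m"
      using assms unfolding connected_poset_def by blast
    then show ?thesis
      using walk_invariant[of "\<lambda>p. \<Sum>z\<in>UNIV. diag_entry z p" u m, OF sum_diag_entry_eq] zero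
      by (simp add: entry_\<phi>_one walk_from_to_def)
  qed
  then have "\<phi> 1 = 0"
    using diagonal_eq_sum[OF \<phi>_one_diagonal] by simp
  moreover have "\<phi> 0 = 0"
    by (rule incidence_pair.linear_0[OF linear])
  ultimately have "(1 :: ('a, 'k) incidence) = 0"
    using injD[OF bij_is_inj[OF bij]] by metis
  then show False by simp
qed

lemma eq_tau:
  assumes \<theta>_bij: "bij_betw \<theta> strict_units strict_units"
    and x: "bij_betw x {1..n} UNIV" and connected: "connected_poset TYPE('a)"
    and c: "\<forall>v w. v < w \<longrightarrow> c (v, w) = gap (v, w)"
    and \<kappa>: "\<And>i. i \<in> {1..n} \<Longrightarrow> \<kappa> i = diag_entry (x i) (x 1)"
  shows "\<phi> = tau x n \<theta> \<sigma> c \<kappa>"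
proof
  fix f
  \<comment> \<open>Along a walk from \<open>x 1\<close> the contributions telescope, and
    \<open>\<kappa> i\<close> supplies the value at the start.\<close>
  have tau_entry: "tau_entry x \<theta> c \<kappa> i v = diag_entry (x i) v" if i: "i \<in> {1..n}" for i v
  proof -
    obtain u m where u: "walk_from_to (x 1) v u m"
      using connected unfolding connected_poset_def by blast
    show ?thesis
      using tau_entry_walk[where x=x, OF \<theta>_bij admissible_gap[OF \<theta>_bij c] u, of \<kappa> i] \<kappa>[OF i] u
        sum_step_contribution_eq[OF \<theta>_bij c, where u=u and m=m and z="x i"]
      by (simp add: walk_from_to_def)
  qed
  have "\<phi> b = tau x n \<theta> \<sigma> c \<kappa> b" if "b \<in> {munit y z | y z. y \<le> z}" for b
  proof -
    from that obtain y z where b: "b = munit y z" "y \<le> z" by blast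
    show ?thesis
    proof (cases "y < z")
      case True
      then show ?thesis by (simp add: b tau_munit \<phi>_munit)
    next
      case False
      then have "z = y" using b by simp
      have "y \<in> x ` {1..n}" using x by (simp add: bij_betw_def)
      then obtain i where i: "i \<in> {1..n}" "y = x i" by blast
      have "\<phi> (munit y y) = (\<Sum>v\<in>UNIV. iscale (diag_entry y v) (munit v v))"
        unfolding diag_entry_def by (rule diagonal_eq_sum[OF \<phi>_diagonal])
      then show ?thesis
        by (simp add: b \<open>z = y\<close> i(2) tau_munit_diagonal[OF x i(1)] tau_entry[OF i(1)])
    qed
  qed
  then show "\<phi> f = tau x n \<theta> \<sigma> c \<kappa> f"
    by (rule incidence_pair.linear_eq_on_span[OF linear linear_tau, where B="{munit y z | y z. y \<le> z}"])
      (simp_all add: span_munit)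
qed

end

text \<open>Consecutive elements of a maximal chain are covers, so the values of a function that is
  constant on maximal chains are determined by those at the preimages of covers.\<close>

lemma monotone_preimage_cover:
  fixes v w :: "'a::{finite, order}"
  assumes mono: "monotone_on_maximal_chains \<theta>" and "v < w"
  obtains y z p q where "y < z" "p < q" "\<And>r. \<not> (p < r \<and> r < q)" "\<theta> (munit y z) = munit p q"
    "\<And>c. constant_on_maximal_chains c \<Longrightarrow> c (v, w) = c (y, z)"
proof -
  obtain u m i j where u: "maximal_chain u m" and ij: "1 \<le> i" "i < j" "j \<le> m" "u i = v" "u j = w"
    using maximal_chain_through[OF assms(2)] by metis
  have m: "1 < m" "Suc 1 \<le> m" using ij by auto
  \<comment> \<open>All pairs of the chain share one value, so its first edge can stand in for
    \<open>(v, w)\<close>.\<close>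
  have c: "c (v, w) = c (u 1, u (Suc 1))" if "constant_on_maximal_chains c" for c :: "'a \<times> 'a \<Rightarrow> 'c"
  proof -
    have "c (u i, u j) = c (u 1, u m)" "c (u 1, u (Suc 1)) = c (u 1, u m)"
      using that u ij m unfolding constant_on_maximal_chains_def by blast+
    then show ?thesis using ij by simp
  qed
  have "u 1 < u (Suc 1)"
    using maximal_chain_covering(1)[OF u, of 1] m by simp
  have "increasing_on_chain \<theta> u m \<or> decreasing_on_chain \<theta> u m"
    using mono u unfolding monotone_on_maximal_chains_def by blast
  then show thesis
  proof
    assume "increasing_on_chain \<theta> u m"
    then obtain v' where v': "maximal_chain v' m" "\<theta> (munit (u 1) (u (Suc 1))) = munit (v' 1) (v' (Suc 1))"
      using m unfolding increasing_on_chain_def by (metis lessI order_refl)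
    show thesis
      by (rule that[OF \<open>u 1 < u (Suc 1)\<close> _ _ v'(2) c])
        (use maximal_chain_covering[OF v'(1), of 1] m in auto)
  next
    assume "decreasing_on_chain \<theta> u m"
    then obtain v' where v': "maximal_chain v' m"
      "\<theta> (munit (u 1) (u (Suc 1))) = munit (v' (m - Suc 1 + 1)) (v' (m - 1 + 1))"
      using m unfolding decreasing_on_chain_def by (metis lessI order_refl)
    \<comment> \<open>In the decreasing case the first edge is sent to the last edge of
      \<open>v'\<close>, again a cover.\<close>
    have "m - Suc 1 + 1 = m - 1" "m - 1 + 1 = Suc (m - 1)" using m by auto
    with v' have v'': "\<theta> (munit (u 1) (u (Suc 1))) = munit (v' (m - 1)) (v' (Suc (m - 1)))"
      by simp
    show thesis
      by (rule that[OF \<open>u 1 < u (Suc 1)\<close> _ _ v'' c])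
        (use maximal_chain_covering[OF v'(1), of "m - 1"] m in auto)
  qed
qed

section \<open>Recovering the parameters from \<open>tau\<close>\<close>

lemma tau_parameter_entry:
  assumes \<theta>: "bij_betw \<theta> strict_units strict_units" and adm: "admissible \<theta> c"
    and x: "bij_betw x {1..n} UNIV" and i: "i \<in> {1..n}"
  shows "\<kappa> i = entry (tau x n \<theta> \<sigma> c \<kappa> (munit (x i) (x i))) (x 1) (x 1)"
proof -
  \<comment> \<open>The walk of length 0 has no contributions, so the entry at \<open>x 1\<close> is
    \<open>\<kappa> i\<close> itself.\<close>
  have "walk_from_to (x 1) (x 1) (\<lambda>_. x 1) 0"
    by (simp add: walk_from_to_def walk_def)
  from tau_entry_walk[where x=x, OF \<theta> adm this, of \<kappa> i] show ?thesis
    by (simp add: entry_tau_munit_diagonal[OF x i])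
qed

text \<open>As \<open>q\<close> covers \<open>p\<close>, a walk ending at \<open>p\<close> extends
  by one step to \<open>q\<close>. The two entries of \<open>tau\<close> then differ by that last
  contribution, which is \<open>- c (v, w)\<close>.\<close>

lemma tau_parameter_cover:
  fixes x :: "nat \<Rightarrow> 'a::{finite, order}"
  assumes \<theta>: "bij_betw \<theta> strict_units strict_units" and adm: "admissible \<theta> c"
    and x: "bij_betw x {1..n} UNIV" and connected: "connected_poset TYPE('a)"
    and vw: "v < w" "\<theta> (munit v w) = munit p q" and cover: "p < q" "\<And>r. \<not> (p < r \<and> r < q)"
  shows "c (v, w) = entry (tau x n \<theta> \<sigma> c \<kappa> (munit v v)) p p - entry (tau x n \<theta> \<sigma> c \<kappa> (munit v v)) q q"
proof -
  have "v \<in> x ` {1..n}" using x by (simp add: bij_betw_def)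
  then obtain i where i: "i \<in> {1..n}" "v = x i" by blast
  obtain u m where u: "walk_from_to (x 1) p u m"
    using connected unfolding connected_poset_def by blast
  have u': "walk_from_to (x 1) q (u(Suc m := q)) (Suc m)"
    using u cover(1) interval_length_covering[OF cover]
    by (auto simp: walk_from_to_def walk_def less_Suc_eq)
  have "(\<Sum>j<m. step_contribution \<theta> c ((u(Suc m := q)) j) ((u(Suc m := q)) (Suc j)) v) =
      (\<Sum>j<m. step_contribution \<theta> c (u j) (u (Suc j)) v)"
    by (intro sum.cong) auto
  moreover have "u m = p" using u by (simp add: walk_from_to_def)
  ultimately have "tau_entry x \<theta> c \<kappa> i q = tau_entry x \<theta> c \<kappa> i p + step_contribution \<theta> c p q v"
    using tau_entry_walk[where x=x, OF \<theta> adm u, of \<kappa> i]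
      tau_entry_walk[where x=x, OF \<theta> adm u', of \<kappa> i] i(2) by simp
  moreover have "step_contribution \<theta> c p q v = - c (v, w)"
  proof -
    obtain v' w' where "preimage_pair \<theta> p q = (v', w')"
      "\<forall>a b. a < b \<longrightarrow> (\<theta> (munit a b) = munit p q \<longleftrightarrow> a = v' \<and> b = w')"
      by (rule preimage_pair[OF \<theta> cover(1)])
    then have "preimage_pair \<theta> p q = (v, w)" using vw by blast
    then show ?thesis using cover(1) by (simp add: step_contribution_def)
  qed
  ultimately show ?thesis
    by (simp add: i(2) entry_tau_munit_diagonal[OF x i(1)])
qed

text \<open>The extensional function spaces \<open>\<rightarrow>\<^sub>E\<close> fix all values
  outside the relevant domains, so that uniqueness can be stated as equality of functions.\<close>

definition tau_parameters ::
    "(nat \<Rightarrow> 'a::{finite, order}) \<Rightarrow> nat \<Rightarrow> (('a, 'k::field) incidence \<Rightarrow> ('a, 'k) incidence) \<Rightarrow>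
     (('a, 'k) incidence \<Rightarrow> ('a, 'k) incidence) \<Rightarrow> ('a \<times> 'a \<Rightarrow> 'k) \<Rightarrow> ('a \<times> 'a \<Rightarrow> 'k) \<Rightarrow>
     (nat \<Rightarrow> 'k) \<Rightarrow> bool" where
  "tau_parameters x n \<phi> \<theta> \<sigma> c \<kappa> \<longleftrightarrow>
    \<theta> \<in> strict_units \<rightarrow>\<^sub>E strict_units \<and> bij_betw \<theta> strict_units strict_units \<and>
    monotone_on_maximal_chains \<theta> \<and>
    \<sigma> \<in> strict_pairs \<rightarrow>\<^sub>E - {0} \<and> c \<in> strict_pairs \<rightarrow>\<^sub>E - {0} \<and>
    compatible \<theta> c \<sigma> \<and> constant_on_maximal_chains c \<and> admissible \<theta> c \<and>
    \<kappa> \<in> {1..n} \<rightarrow>\<^sub>E UNIV \<and> (\<Sum>i=1..n. \<kappa> i) \<noteq> 0 \<and>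
    \<phi> = tau x n \<theta> \<sigma> c \<kappa>"

text \<open>The images of strict units give \<open>\<theta>\<close> and \<open>\<sigma>\<close>,
  differences of diagonal entries across covers give \<open>c\<close>, and the entries at
  \<open>x 1\<close> give \<open>\<kappa>\<close>.\<close>

lemma tau_parameters_unique:
  fixes x :: "nat \<Rightarrow> 'a::{finite, order}"
  assumes x: "bij_betw x {1..n} UNIV" and connected: "connected_poset TYPE('a)"
    and P: "tau_parameters x n \<phi> \<theta> \<sigma> c \<kappa>" and P': "tau_parameters x n \<phi> \<theta>' \<sigma>' c' \<kappa>'"
  shows "\<theta> = \<theta>' \<and> \<sigma> = \<sigma>' \<and> c = c' \<and> \<kappa> = \<kappa>'"
proof -
  note P = P[unfolded tau_parameters_def] and P' = P'[unfolded tau_parameters_def]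
  have bij: "bij_betw \<theta> strict_units strict_units" "bij_betw \<theta>' strict_units strict_units"
    and adm: "admissible \<theta> c" "admissible \<theta>' c'"
    and tau: "\<phi> = tau x n \<theta> \<sigma> c \<kappa>" "\<phi> = tau x n \<theta>' \<sigma>' c' \<kappa>'"
    and \<theta>_ext: "\<theta> \<in> strict_units \<rightarrow>\<^sub>E strict_units" "\<theta>' \<in> strict_units \<rightarrow>\<^sub>E strict_units"
    and \<sigma>_ext: "\<sigma> \<in> strict_pairs \<rightarrow>\<^sub>E - {0}" "\<sigma>' \<in> strict_pairs \<rightarrow>\<^sub>E - {0}"
    and c_ext: "c \<in> strict_pairs \<rightarrow>\<^sub>E - {0}" "c' \<in> strict_pairs \<rightarrow>\<^sub>E - {0}"
    and \<kappa>_ext: "\<kappa> \<in> {1..n} \<rightarrow>\<^sub>E UNIV" "\<kappa>' \<in> {1..n} \<rightarrow>\<^sub>E UNIV"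
    and mono: "monotone_on_maximal_chains \<theta>"
    and const: "constant_on_maximal_chains c" "constant_on_maximal_chains c'"
    using P P' by blast+
  have eq: "\<theta> (munit y z) = \<theta>' (munit y z) \<and> \<sigma> (y, z) = \<sigma>' (y, z)" if yz: "y < z" for y z
  proof -
    have "munit y z \<in> strict_units" using yz by (auto simp: strict_units_def)
    then have "\<theta> (munit y z) \<in> strict_units" "\<theta>' (munit y z) \<in> strict_units"
      using bij by (auto dest: bij_betwE)
    then obtain p q p' q' where pq: "p < q" "\<theta> (munit y z) = munit p q"
      "p' < q'" "\<theta>' (munit y z) = munit p' q'"
      unfolding strict_units_def by blast
    have "\<sigma> (y, z) \<noteq> 0" "\<sigma>' (y, z) \<noteq> 0"
      using \<sigma>_ext yz by (auto simp: strict_pairs_def PiE_iff)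
    moreover have "iscale (\<sigma> (y, z)) (munit p q) = iscale (\<sigma>' (y, z)) (munit p' q')"
      using tau_munit[OF yz, of x n \<theta> \<sigma> c \<kappa>] tau_munit[OF yz, of x n \<theta>' \<sigma>' c' \<kappa>'] tau pq by metis
    ultimately show ?thesis
      using iscale_munit_inject[OF pq(1)] pq by metis
  qed
  have \<theta>: "\<theta> = \<theta>'"
  proof (rule PiE_ext[OF \<theta>_ext])
    fix e :: "('a, 'b) incidence" assume "e \<in> strict_units"
    then show "\<theta> e = \<theta>' e" using eq by (auto simp: strict_units_def)
  qed
  moreover have "\<sigma> = \<sigma>'"
  proof (rule PiE_ext[OF \<sigma>_ext])
    fix yz :: "'a \<times> 'a" assume "yz \<in> strict_pairs"
    then show "\<sigma> yz = \<sigma>' yz" using eq by (auto simp: strict_pairs_def)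
  qed
  moreover have "c = c'"
  proof (rule PiE_ext[OF c_ext])
    fix vw :: "'a \<times> 'a" assume "vw \<in> strict_pairs"
    then obtain v w where vw: "vw = (v, w)" "v < w" by (auto simp: strict_pairs_def)
    \<comment> \<open>Since \<open>\<theta> = \<theta>'\<close> is already known, one cover
      determines the values of both \<open>c\<close> and \<open>c'\<close> at
      \<open>(v, w)\<close>.\<close>
    obtain y z p q where yz: "y < z" "p < q" "\<And>r. \<not> (p < r \<and> r < q)" "\<theta> (munit y z) = munit p q"
      "\<And>c. constant_on_maximal_chains c \<Longrightarrow> c (v, w) = (c (y, z) :: 'b)"
      by (rule monotone_preimage_cover[OF mono vw(2)]) (rule that)
    have "c (y, z) = entry (\<phi> (munit y y)) p p - entry (\<phi> (munit y y)) q q"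
      unfolding tau(1) by (rule tau_parameter_cover[OF bij(1) adm(1) x connected yz(1,4,2,3)])
    moreover have "c' (y, z) = entry (\<phi> (munit y y)) p p - entry (\<phi> (munit y y)) q q"
      unfolding tau(2)
      by (rule tau_parameter_cover[OF bij(2) adm(2) x connected yz(1) yz(4)[unfolded \<theta>] yz(2,3)])
    moreover have "c (v, w) = c (y, z)" "c' (v, w) = c' (y, z)"
      using yz(5) const by blast+
    ultimately show "c vw = c' vw" by (simp add: vw(1))
  qed
  moreover have "\<kappa> = \<kappa>'"
  proof (rule PiE_ext[OF \<kappa>_ext])
    fix i assume "i \<in> {1..n}"
    then show "\<kappa> i = \<kappa>' i"
      using tau_parameter_entry[OF bij(1) adm(1) x, of i \<kappa> \<sigma>]
        tau_parameter_entry[OF bij(2) adm(2) x, of i \<kappa>' \<sigma>'] tau by metis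
  qed
  ultimately show ?thesis by blast
qed

section \<open>Existence of the parameters\<close>

lemma strict_units_map_on_pairs:
  fixes \<theta> :: "('a::order, 'k::field) incidence \<Rightarrow> ('a, 'k) incidence"
  assumes "bij_betw \<theta> strict_units strict_units"
  obtains T where "bij_betw T strict_pairs strict_pairs"
    "\<And>x y p q. x < y \<Longrightarrow> T (x, y) = (p, q) \<Longrightarrow> \<theta> (munit x y) = munit p q"
proof -
  \<comment> \<open>Conjugating \<open>\<theta>\<close> by this bijection from strict pairs to
    strict units gives \<open>T\<close>.\<close>
  define g where "g = (\<lambda>(x, y). munit x y :: ('a, 'k) incidence)"
  have g: "bij_betw g strict_pairs strict_units"
    by (auto simp: bij_betw_def inj_on_def g_def strict_pairs_def strict_units_def munit_inject)
  define T where "T = the_inv_into strict_pairs g \<circ> \<theta> \<circ> g"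
  have "bij_betw T strict_pairs strict_pairs"
    unfolding T_def by (intro bij_betw_trans[OF g] bij_betw_trans[OF assms] bij_betw_the_inv_into g)
  moreover have "g (T P) = \<theta> (g P)" if "P \<in> strict_pairs" for P
    using that bij_betwE[OF g] bij_betwE[OF assms] f_the_inv_into_f_bij_betw[OF g]
    by (simp add: T_def)
  ultimately show thesis
    by (intro that[of T]) (force simp: g_def strict_pairs_def)+
qed

lemma tau_parameters_exist:
  fixes x :: "nat \<Rightarrow> 'a::{finite, order}"
  assumes x: "bij_betw x {1..n} UNIV" and connected: "connected_poset TYPE('a)"
    and pure: "pure_commutativity_preserver (\<phi> :: ('a, 'k::field) incidence \<Rightarrow> _)"
  shows "\<exists>\<theta> \<sigma> c \<kappa>. tau_parameters x n \<phi> \<theta> \<sigma> c \<kappa>"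
proof -
  obtain \<theta>\<^sub>0 \<sigma>\<^sub>0 \<nu> where dec: "unit_decomposition \<phi> \<theta>\<^sub>0 \<sigma>\<^sub>0 \<nu>" "\<And>x y. x < y \<Longrightarrow> \<nu> (munit x y) = 0"
    using pure unfolding pure_commutativity_preserver_def by blast
  \<comment> \<open>Restriction makes the components extensional without changing them where the
    decomposition speaks of them.\<close>
  define \<theta> where "\<theta> = restrict \<theta>\<^sub>0 strict_units"
  define \<sigma> where "\<sigma> = restrict \<sigma>\<^sub>0 strict_pairs"
  have \<theta>: "bij_betw \<theta> strict_units strict_units" "\<theta> \<in> strict_units \<rightarrow>\<^sub>E strict_units"
    using dec(1) unfolding unit_decomposition_def \<theta>_def
    by (auto simp: bij_betw_def inj_on_def)
  have \<sigma>: "\<sigma> \<in> strict_pairs \<rightarrow>\<^sub>E - {0}"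
    using dec(1) unfolding unit_decomposition_def \<sigma>_def by auto
  obtain T where T: "bij_betw T strict_pairs strict_pairs"
    "\<And>x y p q. x < y \<Longrightarrow> T (x, y) = (p, q) \<Longrightarrow> \<theta> (munit x y) = munit p q"
    using strict_units_map_on_pairs[OF \<theta>(1)] by metis
  interpret pure_preserver \<phi> \<theta> T \<sigma>
  proof (rule pure_preserver.intro)
    have "\<phi> (munit x y) = iscale (\<sigma>\<^sub>0 (x, y)) (\<theta>\<^sub>0 (munit x y))" if "x < y" for x y
      using dec that unfolding unit_decomposition_def by simp
    then show "\<phi> (munit x y) = iscale (\<sigma> (x, y)) (\<theta> (munit x y))" if "x < y" for x y
      using that by (auto simp: \<theta>_def \<sigma>_def strict_units_def strict_pairs_def)
    show "\<sigma> (x, y) \<noteq> 0" if "x < y" for x y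
      using \<sigma> that by (auto simp: strict_pairs_def PiE_iff)
    note pure = pure[unfolded pure_commutativity_preserver_def strong_commutativity_preserver_def
      commutativity_preserver_def preserves_diagonality_def]
    show "Vector_Spaces.linear iscale iscale \<phi>" "bij \<phi>"
      using pure by blast+
    show "commutator (\<phi> a) (\<phi> b) = 0 \<longleftrightarrow> commutator a b = 0" for a b
      using pure by blast
    show "\<phi> d \<in> diagonal" if "d \<in> diagonal" for d
      using pure that by blast
  qed (rule T)+
  define c where "c = restrict gap strict_pairs"
  define \<kappa> where "\<kappa> = restrict (\<lambda>i. diag_entry (x i) (x 1)) {1..n}"
  have c: "\<forall>v w. v < w \<longrightarrow> c (v, w) = gap (v, w)"
    by (simp add: c_def strict_pairs_def)
  have "gap (v, w) \<noteq> 0" if "v < w" for v w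
    using gap_nonzero[OF that prod.collapse[symmetric]] .
  then have "c \<in> strict_pairs \<rightarrow>\<^sub>E - {0}"
    by (auto simp: c_def strict_pairs_def)
  moreover have "compatible \<theta> c \<sigma>"
  proof -
    have "c (x, z) = gap (x, z)" if "x < y \<and> y < z" for x y z
      using c that by (meson less_trans)
    then show ?thesis
      using compatible_gap unfolding compatible_def by simp
  qed
  moreover have "constant_on_maximal_chains c"
    unfolding constant_on_maximal_chains_def
  proof (intro allI impI)
    fix u :: "nat \<Rightarrow> 'a" and m i j
    assume u: "maximal_chain u m" and ij: "1 \<le> i \<and> i < j \<and> j \<le> m"
    have "u i < u j" "u 1 < u m"
      using u ij strict_mono_onD[of "{1..m}" u] by (auto simp: maximal_chain_def)
    then show "c (u i, u j) = c (u 1, u m)"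
      using gap_constant_on_maximal_chains[unfolded constant_on_maximal_chains_def, rule_format, OF u ij]
      by (simp add: c)
  qed
  \<comment> \<open>Reindexing along the enumeration \<open>x\<close> turns the sum into the entry
    of \<open>\<phi> 1\<close> at \<open>x 1\<close>.\<close>
  moreover have "(\<Sum>i=1..n. \<kappa> i) \<noteq> 0"
    using sum_diag_entry_nonzero[OF connected, of "x 1"]
      sum.reindex_bij_betw[OF x, of "\<lambda>z. diag_entry z (x 1)"]
    by (simp add: \<kappa>_def)
  moreover have "\<phi> = tau x n \<theta> \<sigma> c \<kappa>"
    by (rule eq_tau[OF \<theta>(1) x connected c]) (simp add: \<kappa>_def)
  moreover have "\<kappa> \<in> {1..n} \<rightarrow>\<^sub>E UNIV"
    by (simp add: \<kappa>_def)
  ultimately have "tau_parameters x n \<phi> \<theta> \<sigma> c \<kappa>"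
    using \<theta> \<sigma> monotone admissible_gap[OF \<theta>(1) c] unfolding tau_parameters_def by blast
  then show ?thesis by blast
qed

theorem theorem3p35:
  fixes x :: "nat \<Rightarrow> 'a::{finite, order}" and n :: nat
    and \<phi> :: "('a, 'k::field) incidence \<Rightarrow> ('a, 'k) incidence"
  assumes "bij_betw x {1..n} UNIV" and "n > 1"
    and "connected_poset TYPE('a)"
    and "pure_commutativity_preserver \<phi>"
  shows "\<exists>!(\<theta>, \<sigma>, c, \<kappa>).
    \<theta> \<in> strict_units \<rightarrow>\<^sub>E strict_units \<and> bij_betw \<theta> strict_units strict_units \<and>
    monotone_on_maximal_chains \<theta> \<and>
    \<sigma> \<in> strict_pairs \<rightarrow>\<^sub>E - {0} \<and> c \<in> strict_pairs \<rightarrow>\<^sub>E - {0} \<and>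
    compatible \<theta> c \<sigma> \<and> constant_on_maximal_chains c \<and> admissible \<theta> c \<and>
    \<kappa> \<in> {1..n} \<rightarrow>\<^sub>E UNIV \<and> (\<Sum>i=1..n. \<kappa> i) \<noteq> 0 \<and>
    \<phi> = tau x n \<theta> \<sigma> c \<kappa>"
  unfolding tau_parameters_def[symmetric]
proof -
  obtain \<theta> \<sigma> c \<kappa> where P: "tau_parameters x n \<phi> \<theta> \<sigma> c \<kappa>"
    using tau_parameters_exist[OF assms(1,3,4)] by blast
  show "\<exists>!(\<theta>, \<sigma>, c, \<kappa>). tau_parameters x n \<phi> \<theta> \<sigma> c \<kappa>"
  proof (rule ex1I[of _ "(\<theta>, \<sigma>, c, \<kappa>)"])
    show "case (\<theta>, \<sigma>, c, \<kappa>) of (\<theta>, \<sigma>, c, \<kappa>) \<Rightarrow> tau_parameters x n \<phi> \<theta> \<sigma> c \<kappa>"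
      using P by simp
    fix t assume "case t of (\<theta>, \<sigma>, c, \<kappa>) \<Rightarrow> tau_parameters x n \<phi> \<theta> \<sigma> c \<kappa>"
    then show "t = (\<theta>, \<sigma>, c, \<kappa>)"
      using tau_parameters_unique[OF assms(1,3) _ P] by (cases t) simp
  qed
qed

end
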